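(* Let $X$ be a (real or complex) Banach space. $REC(\mathbb R,X)$ satisfies $(L_U)$ and $(P_U)$ in each of the following cases: (i) $U=C_b(\mathbb R,X)$ and $c_0\not\subset X$; (ii) $U=C_{b,wscp}(\mathbb R,X)$.
   Context: A continuous $f:\mathbb R\to X$ is recurrent if for each compact $K\subset\mathbb R$ and $\varepsilon>0$ the set $E(f,\varepsilon,K)=\{\tau\in\mathbb R:\|f(t+\tau)-f(t)\|\le\varepsilon\ \forall t\in K\}$ is relatively dense, i.e. there is a compact $L\subset\mathbb R$ with $E(f,\varepsilon,K)+L=\mathbb R$. $REC(\mathbb R,X)$ is the set of recurrent functions. $C_b(\mathbb R,X)$: bounded continuous functions. $C_{b,wscp}(\mathbb R,X)$: those $f\in C_b(\mathbb R,X)$ whose range $f(\mathbb R)$ is relatively weakly sequentially complete, where $M\subset X$ is relatively weakly sequentially complete if every weakly Cauchy sequence from $M$ converges weakly to some $a\in X$. $c_0\not\subset X$ means that $X$ has no subspace isomorphic to the Banach space $c_0$. With $\Delta_hF(t)=F(t+h)-F(t)$ and $Pf(t)=\int_0^tf(s)\,ds$ (Bochner integral): a set $\mathcal A$ of functions $\mathbb R\to X$ satisfies $(L_U)$ if $F\in U$ and $\Delta_hF\in\mathcal A$ for all $h>0$ imply $F\in\mathcal A$; it satisfies $(P_U)$ if $f\in\mathcal A$ and $Pf\in U$ imply $Pf\in\mathcal A$. *)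

theory Defs
  imports "HOL-Analysis.Analysis"
begin

section \<open>Banach spaces over the real or the complex field\<close>

text \<open>
  The library class \<^class>\<open>banach\<close> is about real Banach spaces. A Banach space over a normed field
  \<open>'k\<close> (used below for \<open>'k = real\<close> and \<open>'k = complex\<close>) is a type of that class with a scalar
  multiplication by \<open>'k\<close> that restricts to the built-in real one and for which the given norm
  is a \<open>'k\<close>-norm.
\<close>

locale banach_over = vector_space sc
  for sc :: "'k::real_normed_field \<Rightarrow> 'a::banach \<Rightarrow> 'a" +
  assumes scale_of_real: "sc (of_real r) x = r *\<^sub>R x"
    and norm_scale: "norm (sc c x) = norm c * norm x"

lemma banach_over_scaleR: "banach_over ((*\<^sub>R) :: real \<Rightarrow> 'a::banach \<Rightarrow> 'a)"
  by unfold_locales (auto simp: algebra_simps)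

definition dual :: "('k::real_normed_field \<Rightarrow> 'a::banach \<Rightarrow> 'a) \<Rightarrow> ('a \<Rightarrow> 'k) set" where
  "dual sc = {\<phi>. bounded_linear \<phi> \<and> (\<forall>c x. \<phi> (sc c x) = c * \<phi> x)}"

definition weakly_Cauchy ::
    "('k::real_normed_field \<Rightarrow> 'a::banach \<Rightarrow> 'a) \<Rightarrow> (nat \<Rightarrow> 'a) \<Rightarrow> bool" where
  "weakly_Cauchy sc x \<longleftrightarrow> (\<forall>\<phi>\<in>dual sc. Cauchy (\<lambda>n. \<phi> (x n)))"

definition weakly_converges ::
    "('k::real_normed_field \<Rightarrow> 'a::banach \<Rightarrow> 'a) \<Rightarrow> (nat \<Rightarrow> 'a) \<Rightarrow> 'a \<Rightarrow> bool" where
  "weakly_converges sc x a \<longleftrightarrow> (\<forall>\<phi>\<in>dual sc. (\<lambda>n. \<phi> (x n)) \<longlonglongrightarrow> \<phi> a)"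

definition rel_weakly_seq_complete ::
    "('k::real_normed_field \<Rightarrow> 'a::banach \<Rightarrow> 'a) \<Rightarrow> 'a set \<Rightarrow> bool" where
  "rel_weakly_seq_complete sc M \<longleftrightarrow>
    (\<forall>x. range x \<subseteq> M \<longrightarrow> weakly_Cauchy sc x \<longrightarrow> (\<exists>a. weakly_converges sc x a))"

definition c0 :: "(nat \<Rightarrow> 'k::real_normed_field) set" where
  "c0 = {x. x \<longlonglongrightarrow> 0}"

definition c0_norm :: "(nat \<Rightarrow> 'k::real_normed_field) \<Rightarrow> real" where
  "c0_norm x = (SUP n. norm (x n))"

text \<open>
  \<open>X\<close> contains \<open>c0\<close> (over its own scalar field): some subspace \<open>Y\<close> is the image of a linear
  bijection \<open>T\<close> from \<open>c0\<close> such that \<open>T\<close> and its inverse are bounded.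
\<close>

definition contains_c0 :: "('k::real_normed_field \<Rightarrow> 'a::banach \<Rightarrow> 'a) \<Rightarrow> bool" where
  "contains_c0 sc \<longleftrightarrow>
    (\<exists>(Y :: 'a set) (T :: (nat \<Rightarrow> 'k) \<Rightarrow> 'a).
       module.subspace sc Y \<and> bij_betw T c0 Y \<and>
       (\<forall>x\<in>c0. \<forall>y\<in>c0. T (\<lambda>n. x n + y n) = T x + T y) \<and>
       (\<forall>c. \<forall>x\<in>c0. T (\<lambda>n. c * x n) = sc c (T x)) \<and>
       (\<exists>C. \<forall>x\<in>c0. norm (T x) \<le> C * c0_norm x) \<and>
       (\<exists>C. \<forall>x\<in>c0. c0_norm x \<le> C * norm (T x)))"

section \<open>The Bochner integral\<close>

text \<open>
  The library's \<^const>\<open>has_bochner_integral\<close> requires the target space to be second countable,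
  that is, separable. The following is the same definition without that restriction; the
  approximation by simple functions forces \<open>f\<close> to be essentially separably valued.
\<close>

definition has_Bochner :: "'m measure \<Rightarrow> ('m \<Rightarrow> 'a::banach) \<Rightarrow> 'a \<Rightarrow> bool" where
  "has_Bochner M f x \<longleftrightarrow> f \<in> borel_measurable M \<and>
    (\<exists>s. (\<forall>i. Bochner_Integration.simple_bochner_integrable M (s i)) \<and>
         (\<lambda>i::nat. \<integral>\<^sup>+ t. ennreal (norm (f t - s i t)) \<partial>M) \<longlonglongrightarrow> 0 \<and>
         (\<lambda>i. Bochner_Integration.simple_bochner_integral M (s i)) \<longlonglongrightarrow> x)"

definition Bochner :: "'m measure \<Rightarrow> ('m \<Rightarrow> 'a::banach) \<Rightarrow> 'a" where
  "Bochner M f = (THE x. has_Bochner M f x)"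

text \<open>\<open>prim f t\<close> is the oriented integral of \<open>f\<close> from \<open>0\<close> to \<open>t\<close>.\<close>

definition prim :: "(real \<Rightarrow> 'a::banach) \<Rightarrow> real \<Rightarrow> 'a" where
  "prim f t = (if 0 \<le> t then Bochner (restrict_space lborel {0..t}) f
            else - Bochner (restrict_space lborel {t..0}) f)"

text \<open>
  On continuous functions this agrees with the Henstock-Kurzweil integral of the library
  (lemma \<open>prim_continuous\<close> below).
\<close>

lemma borel_measurable_norm_diff_simple:
  fixes f :: "'m \<Rightarrow> 'a::banach"
  assumes f: "f \<in> borel_measurable M" and s: "simple_function M s"
  shows "(\<lambda>x. norm (f x - s x)) \<in> borel_measurable M"
proof (rule measurable_compose_countable'[where I = "s ` space M" and g = s])
  fix y
  have "(\<lambda>z::'a. norm (z - y)) \<in> borel_measurable borel"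
    by (intro borel_measurable_continuous_onI continuous_intros)
  from measurable_compose[OF f this]
  show "(\<lambda>x. norm (f x - y)) \<in> borel_measurable M" .
next
  show "countable (s ` space M)"
    using s by (simp add: simple_function_def countable_finite)
  show "s \<in> M \<rightarrow>\<^sub>M count_space (s ` space M)"
    using s by (auto simp: measurable_count_space_eq2 simple_function_def)
qed

lemma has_Bochner_unique:
  fixes f :: "'m \<Rightarrow> 'a::banach"
  assumes "has_Bochner M f x" "has_Bochner M f y"
  shows "x = y"
proof -
  from assms obtain s t where f: "f \<in> borel_measurable M"
    and s: "\<And>i. Bochner_Integration.simple_bochner_integrable M (s i)"
      "(\<lambda>i::nat. \<integral>\<^sup>+ t. ennreal (norm (f t - s i t)) \<partial>M) \<longlonglongrightarrow> 0"
      "(\<lambda>i. Bochner_Integration.simple_bochner_integral M (s i)) \<longlonglongrightarrow> x"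
    and t: "\<And>i. Bochner_Integration.simple_bochner_integrable M (t i)"
      "(\<lambda>i::nat. \<integral>\<^sup>+ u. ennreal (norm (f u - t i u)) \<partial>M) \<longlonglongrightarrow> 0"
      "(\<lambda>i. Bochner_Integration.simple_bochner_integral M (t i)) \<longlonglongrightarrow> y"
    unfolding has_Bochner_def by blast
  let ?d = "\<lambda>i. norm (Bochner_Integration.simple_bochner_integral M (s i) - Bochner_Integration.simple_bochner_integral M (t i))"
  let ?e = "\<lambda>i. (\<integral>\<^sup>+ u. ennreal (norm (f u - s i u)) \<partial>M) + (\<integral>\<^sup>+ u. ennreal (norm (f u - t i u)) \<partial>M)"
  have le: "ennreal (?d i) \<le> ?e i" for i
  proof -
    have st: "Bochner_Integration.simple_bochner_integrable M (\<lambda>u. s i u - t i u)"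
      "Bochner_Integration.simple_bochner_integrable M (\<lambda>u. norm (s i u - t i u))"
      using simple_bochner_integrable_compose2[of "\<lambda>x y. x - y", OF _ s(1) t(1)]
        simple_bochner_integrable_compose2[of "\<lambda>x y. norm (x - y)", OF _ s(1) t(1)] by auto
    have "?d i \<le> Bochner_Integration.simple_bochner_integral M (\<lambda>u. norm (s i u - t i u))"
      using simple_bochner_integral_norm_bound[OF st(1)]
      by (simp add: simple_bochner_integral_diff[OF s(1) t(1)])
    then have "ennreal (?d i) \<le> ennreal (Bochner_Integration.simple_bochner_integral M (\<lambda>u. norm (s i u - t i u)))"
      by (rule ennreal_leI)
    also have "\<dots> = (\<integral>\<^sup>+ u. ennreal (norm (s i u - t i u)) \<partial>M)"
      by (rule simple_bochner_integral_eq_nn_integral[OF st(2)]) simp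
    also have "\<dots> \<le> (\<integral>\<^sup>+ u. ennreal (norm (f u - s i u)) + ennreal (norm (f u - t i u)) \<partial>M)"
    proof (intro nn_integral_mono)
      fix u
      have "norm (s i u - t i u) \<le> norm (f u - s i u) + norm (f u - t i u)"
        by (metis dual_order.refl norm_diff_triangle_le norm_minus_commute)
      then show "ennreal (norm (s i u - t i u)) \<le>
          ennreal (norm (f u - s i u)) + ennreal (norm (f u - t i u))"
        by (metis ennreal_leI ennreal_plus norm_ge_zero)
    qed
    also have "\<dots> = ?e i"
      using borel_measurable_norm_diff_simple[OF f, of "s i"]
        borel_measurable_norm_diff_simple[OF f, of "t i"] s(1)[of i] t(1)[of i]
      by (intro nn_integral_add) (auto elim!: simple_bochner_integrable.cases)
    finally show ?thesis .
  qed
  have "?e \<longlonglongrightarrow> 0"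
    using tendsto_add[OF s(2) t(2)] by simp
  then have "(\<lambda>i. ennreal (?d i)) \<longlonglongrightarrow> ennreal 0"
    using le tendsto_sandwich[of "\<lambda>_. 0" "\<lambda>i. ennreal (?d i)" sequentially ?e 0] by simp
  then have "?d \<longlonglongrightarrow> 0"
    by (simp flip: ennreal_0)
  moreover have "?d \<longlonglongrightarrow> norm (x - y)"
    using s(3) t(3) by (intro tendsto_intros)
  ultimately show ?thesis
    using LIMSEQ_unique by fastforce
qed

lemma Bochner_eqI: "has_Bochner M f x \<Longrightarrow> Bochner M f = x"
  unfolding Bochner_def using has_Bochner_unique by blast

lemma has_integral_simple_lborel:
  fixes s :: "real \<Rightarrow> 'a::banach"
  assumes s: "simple_function (restrict_space lborel {a..b}) s"
  shows "(s has_integral Bochner_Integration.simple_bochner_integral (restrict_space lborel {a..b}) s) {a..b}"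
proof -
  let ?M = "restrict_space lborel {a..b}"
  have sp: "space ?M = {a..b}" by simp
  have fin: "finite (s ` {a..b})"
    using s by (simp add: simple_function_def)
  let ?A = "\<lambda>y. {x\<in>{a..b}. s x = y}"
  have A: "?A y \<in> sets lborel" "measure ?M (?A y) = measure lborel (?A y)"
    "emeasure lborel (?A y) < \<infinity>" for y
  proof -
    show m: "?A y \<in> sets lborel"
    proof (cases "y \<in> s ` {a..b}")
      case True
      then have "s -` {y} \<inter> space ?M \<in> sets ?M"
        using s by (auto simp: simple_function_def)
      moreover have "s -` {y} \<inter> space ?M = ?A y" by auto
      ultimately show ?thesis
        by (simp add: sets_restrict_space_iff)
    next
      case False
      then have "?A y = {}" by auto
      then show ?thesis by (simp only: sets.empty_sets)
    qed
    show "measure ?M (?A y) = measure lborel (?A y)"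
      by (rule measure_restrict_space) auto
    have "emeasure lborel (?A y) \<le> emeasure lborel {a..b}"
      by (rule emeasure_mono) auto
    also have "\<dots> < \<infinity>" by (simp add: emeasure_lborel_Icc_eq)
    finally show "emeasure lborel (?A y) < \<infinity>" .
  qed
  have "((\<lambda>x. indicator (?A y) x *\<^sub>R y) has_integral (measure lborel (?A y) *\<^sub>R y)) {a..b}" for y
  proof -
    have "((\<lambda>x. 1::real) has_integral measure lborel (?A y)) (?A y)"
      using A by (intro has_integral_measure_lborel) auto
    then have "((\<lambda>x. if x \<in> ?A y then 1 else 0::real) has_integral measure lborel (?A y)) {a..b}"
      by (subst has_integral_restrict) auto
    then have "((\<lambda>x. indicator (?A y) x :: real) has_integral measure lborel (?A y)) {a..b}"
      by (rule has_integral_eq[rotated]) (auto simp: indicator_def)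
    then show ?thesis by (rule has_integral_scaleR_left)
  qed
  then have "((\<lambda>x. \<Sum>y\<in>s ` {a..b}. indicator (?A y) x *\<^sub>R y) has_integral
      (\<Sum>y\<in>s ` {a..b}. measure lborel (?A y) *\<^sub>R y)) {a..b}"
    by (intro has_integral_sum fin)
  moreover have "(\<Sum>y\<in>s ` {a..b}. indicator (?A y) x *\<^sub>R y) = s x" if "x \<in> {a..b}" for x
  proof -
    have "(\<Sum>y\<in>s ` {a..b}. indicator (?A y) x *\<^sub>R y) = (\<Sum>y\<in>s ` {a..b}. if s x = y then y else 0)"
      using that by (intro sum.cong) (auto simp: indicator_def)
    also have "\<dots> = s x"
      using that fin by (simp add: sum.delta')
    finally show ?thesis .
  qed
  ultimately have "(s has_integral (\<Sum>y\<in>s ` {a..b}. measure lborel (?A y) *\<^sub>R y)) {a..b}"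
    by (rule has_integral_eq[rotated])
  then show ?thesis
    unfolding simple_bochner_integral_def sp A(2) .
qed

lemma has_Bochner_continuous:
  fixes f :: "real \<Rightarrow> 'a::banach"
  assumes f: "continuous_on {a..b} f"
  shows "has_Bochner (restrict_space lborel {a..b}) f (integral {a..b} f)"
proof -
  let ?M = "restrict_space lborel {a..b}"
  define g where "g n x = max a (of_int \<lfloor>real (Suc n) * x\<rfloor> / real (Suc n))" for n x
  define s where "s n x = f (g n x)" for n x
  have g_le: "g n x \<le> x" "a \<le> g n x" "x - g n x < 1 / real (Suc n)" if "x \<in> {a..b}" for n x
  proof -
    have "of_int \<lfloor>real (Suc n) * x\<rfloor> \<le> real (Suc n) * x" "real (Suc n) * x < of_int \<lfloor>real (Suc n) * x\<rfloor> + 1"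
      by linarith+
    then have "of_int \<lfloor>real (Suc n) * x\<rfloor> / real (Suc n) \<le> x"
      "x < of_int \<lfloor>real (Suc n) * x\<rfloor> / real (Suc n) + 1 / real (Suc n)"
      by (simp_all add: field_simps)
    with that show "g n x \<le> x" "a \<le> g n x" "x - g n x < 1 / real (Suc n)"
      unfolding g_def by auto
  qed
  have simp_g: "simple_function ?M (g n)" for n
  proof -
    have "(\<lambda>x. g n x) \<in> borel_measurable lborel"
      unfolding g_def by measurable
    then have "g n \<in> borel_measurable ?M"
      by (rule measurable_restrict_space1)
    moreover have "finite (g n ` space ?M)"
    proof (rule finite_subset)
      show "g n ` space ?M \<subseteq> (\<lambda>k. max a (of_int k / real (Suc n))) `
          {\<lfloor>real (Suc n) * a\<rfloor>..\<lfloor>real (Suc n) * b\<rfloor>}"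
        unfolding g_def by (auto intro!: imageI floor_mono mult_left_mono)
    qed simp
    ultimately show ?thesis
      by (simp add: simple_function_borel_measurable)
  qed
  have simp_s: "simple_function ?M (s n)" for n
    unfolding s_def by (rule simple_function_compose1[OF simp_g])
  have space_fin: "emeasure ?M A < \<infinity>" for A
  proof -
    have "emeasure ?M A \<le> emeasure ?M (space ?M)"
      by (rule emeasure_space)
    also have "\<dots> = emeasure lborel {a..b}"
      by (simp add: emeasure_restrict_space)
    also have "\<dots> < \<infinity>"
      by (simp add: emeasure_lborel_Icc_eq)
    finally show ?thesis .
  qed
  have sbi: "Bochner_Integration.simple_bochner_integrable ?M (s n)" for n
    using simp_s space_fin[THEN less_imp_neq] by (intro simple_bochner_integrable.intros)
  have uc: "uniformly_continuous_on {a..b} f"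
    using f by (intro compact_uniformly_continuous) auto
  have close: "\<forall>\<^sub>F n in sequentially. \<forall>x\<in>{a..b}. norm (f x - s n x) \<le> e" if "e > 0" for e
  proof -
    obtain d where d: "d > 0"
      "\<And>x y. x \<in> {a..b} \<Longrightarrow> y \<in> {a..b} \<Longrightarrow> dist y x < d \<Longrightarrow> dist (f y) (f x) < e"
      using uc \<open>e > 0\<close> unfolding uniformly_continuous_on_def by metis
    obtain N where N: "1 / real (Suc N) < d"
      using nat_approx_posE[OF d(1)] by metis
    have "norm (f x - s n x) \<le> e" if "n \<ge> N" "x \<in> {a..b}" for n x
    proof -
      have "1 / real (Suc n) \<le> 1 / real (Suc N)"
        using \<open>n \<ge> N\<close> by (simp add: field_simps)
      with g_le[OF that(2), of n] N have "dist x (g n x) < d"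
        by (simp add: dist_real_def)
      moreover have "g n x \<in> {a..b}"
        using g_le[OF that(2), of n] that(2) by auto
      ultimately show ?thesis
        using d(2)[of "g n x" x] that(2) unfolding s_def by (auto simp: dist_norm)
    qed
    then show ?thesis
      unfolding eventually_sequentially by blast
  qed
  define L where "L = measure lborel {a..b}"
  have L: "L \<ge> 0" "emeasure lborel {a..b} = ennreal L"
    unfolding L_def by (auto simp: measure_def emeasure_lborel_Icc_eq)
  have "(\<lambda>n. \<integral>\<^sup>+ x. ennreal (norm (f x - s n x)) \<partial>?M) \<longlonglongrightarrow> 0"
  proof (rule tendsto_0_if_Limsup_eq_0_ennreal, rule antisym)
    have bnd: "Limsup sequentially (\<lambda>n. \<integral>\<^sup>+ x. ennreal (norm (f x - s n x)) \<partial>?M) \<le> ennreal (e * L)"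
      if "e > 0" for e
    proof (rule Limsup_bounded, rule eventually_mono[OF close[OF that]])
      fix n assume *: "\<forall>x\<in>{a..b}. norm (f x - s n x) \<le> e"
      have "(\<integral>\<^sup>+ x. ennreal (norm (f x - s n x)) \<partial>?M) \<le> (\<integral>\<^sup>+ x. ennreal e \<partial>?M)"
        using * by (intro nn_integral_mono ennreal_leI) auto
      also have "\<dots> = ennreal (e * L)"
        using that L by (simp add: emeasure_restrict_space ennreal_mult)
      finally show "(\<integral>\<^sup>+ x. ennreal (norm (f x - s n x)) \<partial>?M) \<le> ennreal (e * L)" .
    qed
    show "Limsup sequentially (\<lambda>n. \<integral>\<^sup>+ x. ennreal (norm (f x - s n x)) \<partial>?M) \<le> 0"
    proof (rule ennreal_le_epsilon)
      fix e :: real assume "e > 0"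
      have "e / (L + 1) > 0" using \<open>e > 0\<close> L by simp
      from bnd[OF this] have "Limsup sequentially (\<lambda>n. \<integral>\<^sup>+ x. ennreal (norm (f x - s n x)) \<partial>?M)
          \<le> ennreal (e / (L + 1) * L)" .
      also have "\<dots> \<le> ennreal e"
        using \<open>e > 0\<close> L by (intro ennreal_leI) (simp add: field_simps)
      finally show "Limsup sequentially (\<lambda>n. \<integral>\<^sup>+ x. ennreal (norm (f x - s n x)) \<partial>?M) \<le> 0 + ennreal e"
        by simp
    qed
  qed simp
  moreover have "(\<lambda>n. Bochner_Integration.simple_bochner_integral ?M (s n)) \<longlonglongrightarrow> integral {a..b} f"
  proof (rule LIMSEQ_I)
    fix e :: real assume e: "e > 0"
    have fi: "(f has_integral integral {a..b} f) {a..b}"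
      using f by (intro integrable_integral integrable_continuous_interval) auto
    have "e / (L + 1) > 0" using e L by simp
    from close[OF this] obtain N where
      N: "\<And>n x. n \<ge> N \<Longrightarrow> x \<in> {a..b} \<Longrightarrow> norm (f x - s n x) \<le> e / (L + 1)"
      unfolding eventually_sequentially by blast
    have "norm (Bochner_Integration.simple_bochner_integral ?M (s n) - integral {a..b} f) < e" if "n \<ge> N" for n
    proof -
      have "((\<lambda>x. f x - s n x) has_integral integral {a..b} f - Bochner_Integration.simple_bochner_integral ?M (s n)) {a..b}"
        by (rule has_integral_diff[OF fi has_integral_simple_lborel[OF simp_s]])
      then have "norm (integral {a..b} f - Bochner_Integration.simple_bochner_integral ?M (s n)) \<le> e / (L + 1) * measure lborel (cbox a b)"
        using N[OF that] e L by (intro has_integral_bound[where f = "\<lambda>x. f x - s n x"]) (simp_all add: less_imp_le)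
      also have "\<dots> = e / (L + 1) * L"
        by (simp add: L_def)
      also have "\<dots> < e"
        using e L by (simp add: field_simps)
      finally show ?thesis
        by (simp add: norm_minus_commute)
    qed
    then show "\<exists>no. \<forall>n\<ge>no. norm (Bochner_Integration.simple_bochner_integral ?M (s n) - integral {a..b} f) < e"
      by blast
  qed
  moreover have "f \<in> borel_measurable ?M"
    using borel_measurable_continuous_on_restrict[OF f] 
    by (simp cong: measurable_cong_sets add: sets_restrict_space_cong[OF sets_lborel])
  ultimately show ?thesis
    unfolding has_Bochner_def using sbi by blast
qed

lemma prim_continuous:
  fixes f :: "real \<Rightarrow> 'a::banach"
  assumes "continuous_on UNIV f"
  shows "prim f t = (if 0 \<le> t then integral {0..t} f else - integral {t..0} f)"
  unfolding prim_def
  by (simp add: Bochner_eqI[OF has_Bochner_continuous] continuous_on_subset[OF assms])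

section \<open>Recurrent functions and the two properties\<close>

definition E_rec :: "(real \<Rightarrow> 'a::banach) \<Rightarrow> real \<Rightarrow> real set \<Rightarrow> real set" where
  "E_rec f \<epsilon> K = {\<tau>. \<forall>t\<in>K. norm (f (t + \<tau>) - f t) \<le> \<epsilon>}"

definition rel_dense :: "real set \<Rightarrow> bool" where
  "rel_dense S \<longleftrightarrow> (\<exists>L. compact L \<and> {\<tau> + l |\<tau> l. \<tau> \<in> S \<and> l \<in> L} = UNIV)"

definition REC :: "(real \<Rightarrow> 'a::banach) set" where
  "REC = {f. continuous_on UNIV f \<and> (\<forall>K \<epsilon>. compact K \<longrightarrow> \<epsilon> > 0 \<longrightarrow> rel_dense (E_rec f \<epsilon> K))}"

text \<open>\<open>C\<^sub>b(\<real>, X)\<close> is the library's set \<^const>\<open>bcontfun\<close>.\<close>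

definition Cb_wscp :: "('k::real_normed_field \<Rightarrow> 'a::banach \<Rightarrow> 'a) \<Rightarrow> (real \<Rightarrow> 'a) set" where
  "Cb_wscp sc = {f \<in> bcontfun. rel_weakly_seq_complete sc (range f)}"

definition \<Delta> :: "real \<Rightarrow> (real \<Rightarrow> 'a::banach) \<Rightarrow> real \<Rightarrow> 'a" where
  "\<Delta> h F t = F (t + h) - F t"

definition satisfies_L :: "(real \<Rightarrow> 'a::banach) set \<Rightarrow> (real \<Rightarrow> 'a) set \<Rightarrow> bool" where
  "satisfies_L U \<A> \<longleftrightarrow> (\<forall>F\<in>U. (\<forall>h>0. \<Delta> h F \<in> \<A>) \<longrightarrow> F \<in> \<A>)"

definition satisfies_P :: "(real \<Rightarrow> 'a::banach) set \<Rightarrow> (real \<Rightarrow> 'a) set \<Rightarrow> bool" where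
  "satisfies_P U \<A> \<longleftrightarrow> (\<forall>f\<in>\<A>. prim f \<in> U \<longrightarrow> prim f \<in> \<A>)"

end

theory Submission
  imports Defs
begin

text \<open>
  The property \<open>(P\<^sub>U)\<close> follows from \<open>(L\<^sub>U)\<close>: the difference of step \<open>h\<close> of a primitive of \<open>f\<close> at \<open>t\<close>
  is the integral of \<open>f\<close> over \<open>[t, t + h]\<close>, so it inherits the return times of \<open>f\<close>
  (\<open>difference_of_prim_in_REC\<close>).

  For \<open>(L\<^sub>U)\<close>, suppose that \<open>F\<close> is bounded and continuous, that all its differences are recurrent,
  and that \<open>F\<close> is not. This is turned into a series of large vectors with bounded finite sums, in
  the manner of Kadets. A return time \<open>s\<close> of \<open>\<Delta> h F\<close> is a time for which \<open>\<Phi> v = F (v + s) - F v\<close> is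
  almost \<open>h\<close>-periodic on a large interval, and since the return times of \<open>F\<close> are too sparse, \<open>s\<close> can
  be chosen with \<open>\<Phi>\<close> not small on \<open>K\<close>. Such times \<open>s\<^sub>0, s\<^sub>1, \<dots>\<close> are chosen one after the other. Neither
  \<open>F\<close> nor its differences have to be uniformly continuous, so nothing is known about \<open>\<Phi>\<close> between
  the points of a progression of step \<open>h\<close>; two choices make up for this. All return times
  are rational, so that the next step \<open>h\<close> can be an exact common divisor of the earlier times and \<open>\<Phi>\<close>
  hardly changes under translation by their finite sums. Moreover \<open>h\<close> is shorter than the interval
  of base points that is still available, so that a translate of the place where \<open>\<Phi>\<close> is large falls
  into that interval; a smaller interval around it is kept. A point \<open>u\<close> common to all
  these nested intervals makes the set function \<open>A \<mapsto> F (u + sum s A)\<close> additive up to the summable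
  errors \<open>1/2\<^sup>n\<close>, while all the increments \<open>F (u + s n) - F u\<close> stay away from \<open>0\<close>
  (\<open>Kadets_sequence\<close>).

  What remains is about series \<open>\<Sum> x n\<close> whose finite sums are bounded and whose terms are not small.
  Every functional is absolutely summable along such a series. Choosing functionals that norm the
  terms and applying Rosenthal's lemma to the matrix of their values, one obtains a
  subsequence on which each linear combination is detected by the functional that belongs to its largest
  coefficient (\<open>dominant_coefficient_subsequence\<close>). This subsequence spans a copy of \<open>c0\<close>
  (\<open>Bessaga_Pelczynski\<close>), and its partial sums, although weakly Cauchy, have no weak limit
  (\<open>Orlicz_Pettis_subsequence\<close>). The first fact contradicts the absence of \<open>c0\<close>, the second contradicts the
  relative weak sequential completeness of the range of \<open>F\<close>, which contains the points \<open>F (u + sum s A)\<close>.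

  Both scalar fields are treated at once, in a locale that assumes a Hahn-Banach theorem for seminorms;
  that theorem is derived first, from the minimality of linear functionals among the sublinear ones.
\<close>

section \<open>The Hahn-Banach theorem\<close>

text \<open>Homogeneity is only required as an inequality for positive factors; applying it to the
  inverse factor gives equality, and the value at \<open>0\<close> follows.\<close>

definition sublinear :: "('a::real_vector \<Rightarrow> real) \<Rightarrow> bool" where
  "sublinear p \<longleftrightarrow> (\<forall>x y. p (x + y) \<le> p x + p y) \<and> (\<forall>r>0. \<forall>x. p (r *\<^sub>R x) \<le> r * p x)"

lemma sublinear_add: "sublinear p \<Longrightarrow> p (x + y) \<le> p x + p y"
  by (simp add: sublinear_def)

lemma sublinear_zero:
  assumes "sublinear p"
  shows "p 0 = 0"
proof -
  have "p (2 *\<^sub>R 0) \<le> 2 * p 0" "p ((1/2) *\<^sub>R 0) \<le> (1/2) * p 0"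
    using assms by (simp_all only: sublinear_def)
  then show ?thesis by simp
qed

lemma sublinear_scaleR:
  assumes p: "sublinear p" and r: "r \<ge> 0"
  shows "p (r *\<^sub>R x) = r * p x"
proof (cases "r = 0")
  case True
  then show ?thesis using sublinear_zero[OF p] by simp
next
  case False
  then have r: "r > 0" using r by simp
  have "p (inverse r *\<^sub>R (r *\<^sub>R x)) \<le> inverse r * p (r *\<^sub>R x)"
    using p r by (simp only: sublinear_def positive_imp_inverse_positive)
  then have "r * p x \<le> p (r *\<^sub>R x)"
    using r by (simp add: field_simps)
  moreover have "p (r *\<^sub>R x) \<le> r * p x"
    using p r by (simp add: sublinear_def)
  ultimately show ?thesis by simp
qed

lemma sublinear_minus: "sublinear p \<Longrightarrow> - p (- x) \<le> p x"
  using sublinear_add[of p x "- x"] sublinear_zero[of p] by simp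

text \<open>
  The functional \<open>q\<close> is the limit of \<open>p (x + t *\<^sub>R b) - t * p b\<close> as \<open>t\<close> grows, which decreases in \<open>t\<close>.
  It is affine along the direction \<open>b\<close>. This one construction serves twice: applied to a
  minimal sublinear functional it cannot lower anything, which forces additivity, and applied to the
  given \<open>p\<close> it prescribes the value of the later linear minorant at \<open>b\<close>.
\<close>

lemma sublinear_shave:
  assumes p: "sublinear p"
  obtains q where "sublinear q" "\<And>x. q x \<le> p x" "\<And>x. q x \<le> p (x + b) - p b"
proof -
  define q where "q x = (INF t\<in>{0..}. p (x + t *\<^sub>R b) - t * p b)" for x
  have low: "- p (- x) \<le> p (x + t *\<^sub>R b) - t * p b" if "t \<ge> 0" for x t
    using sublinear_add[OF p, of "x + t *\<^sub>R b" "- x"] sublinear_scaleR[OF p that, of b] by simp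
  then have bdd: "bdd_below ((\<lambda>t. p (x + t *\<^sub>R b) - t * p b) ` {0..})" for x
    by (auto intro!: bdd_belowI2)
  have q_le: "q x \<le> p (x + t *\<^sub>R b) - t * p b" if "t \<ge> 0" for x t
    unfolding q_def using that by (intro cINF_lower[OF bdd]) auto
  have q_ge: "c \<le> q x" if "\<And>t. t \<ge> 0 \<Longrightarrow> c \<le> p (x + t *\<^sub>R b) - t * p b" for x c
    unfolding q_def using that by (intro cINF_greatest) auto
  have "q (x + y) \<le> q x + q y" for x y
  proof -
    have "q (x + y) - (p (y + t *\<^sub>R b) - t * p b) \<le> q x" if t: "t \<ge> 0" for t
    proof (rule q_ge)
      fix s :: real assume s: "s \<ge> 0"
      have "q (x + y) \<le> p ((x + y) + (s + t) *\<^sub>R b) - (s + t) * p b"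
        using s t by (intro q_le) auto
      also have "(x + y) + (s + t) *\<^sub>R b = (x + s *\<^sub>R b) + (y + t *\<^sub>R b)"
        by (simp add: algebra_simps)
      also have "p \<dots> \<le> p (x + s *\<^sub>R b) + p (y + t *\<^sub>R b)"
        by (rule sublinear_add[OF p])
      finally show "q (x + y) - (p (y + t *\<^sub>R b) - t * p b) \<le> p (x + s *\<^sub>R b) - s * p b"
        by (simp add: algebra_simps)
    qed
    then have "q (x + y) - q x \<le> q y"
      by (intro q_ge) (simp add: algebra_simps)
    then show ?thesis by simp
  qed
  moreover have "q (r *\<^sub>R x) \<le> r * q x" if r: "r > 0" for r x
  proof -
    have "q (r *\<^sub>R x) / r \<le> q x"
    proof (rule q_ge)
      fix t :: real assume t: "t \<ge> 0"
      have "q (r *\<^sub>R x) \<le> p (r *\<^sub>R x + (r * t) *\<^sub>R b) - (r * t) * p b"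
        using r t by (intro q_le) auto
      also have "r *\<^sub>R x + (r * t) *\<^sub>R b = r *\<^sub>R (x + t *\<^sub>R b)"
        by (simp add: algebra_simps)
      also have "p \<dots> = r * p (x + t *\<^sub>R b)"
        using r by (intro sublinear_scaleR[OF p]) simp
      finally show "q (r *\<^sub>R x) / r \<le> p (x + t *\<^sub>R b) - t * p b"
        using r by (simp add: field_simps)
    qed
    then show ?thesis using r by (simp add: field_simps)
  qed
  ultimately have "sublinear q" by (simp add: sublinear_def)
  moreover have "q x \<le> p x" for x using q_le[of 0 x] by simp
  moreover have "q x \<le> p (x + b) - p b" for x using q_le[of 1 x] by simp
  ultimately show ?thesis using that by blast
qed

lemma minimal_sublinear_linear:
  assumes q: "sublinear q"
    and min: "\<And>q'. sublinear q' \<Longrightarrow> (\<And>x. q' x \<le> q x) \<Longrightarrow> q' = q"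
  shows "linear q"
proof -
  have add: "q (x + y) = q x + q y" for x y
  proof -
    obtain q' where q': "sublinear q'" "\<And>x. q' x \<le> q x" "\<And>x. q' x \<le> q (x + y) - q y"
      using sublinear_shave[OF q] by metis
    then have "q' = q" by (intro min)
    then have "q x \<le> q (x + y) - q y" using q'(3) by simp
    then show ?thesis using sublinear_add[OF q, of x y] by simp
  qed
  have minus: "q (- x) = - q x" for x
    using add[of x "- x"] sublinear_zero[OF q] by simp
  have "q (r *\<^sub>R x) = r * q x" for r x
    using sublinear_scaleR[OF q, of r x] sublinear_scaleR[OF q, of "- r" x]
    by (cases "r \<ge> 0") (simp_all add: minus)
  with add show ?thesis by (intro linearI) auto
qed

text \<open>Zorn's lemma applies because a chain of sublinear minorants of \<open>p\<close> is bounded below by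
  \<open>- p (- x)\<close>, and its pointwise infimum is subadditive: of two members of the chain, the smaller one
  serves at both arguments.\<close>

lemma minimal_sublinear_exists:
  fixes p :: "'a::real_vector \<Rightarrow> real"
  assumes p: "sublinear p"
  obtains q where "sublinear q" "\<And>x. q x \<le> p x"
    "\<And>q'. sublinear q' \<Longrightarrow> (\<And>x. q' x \<le> q x) \<Longrightarrow> q' = q"
proof -
  define S where "S = {q. sublinear q \<and> (\<forall>x. q x \<le> p x)}"
  define below where "below q q' \<longleftrightarrow> (\<forall>x. q' x \<le> q x)" for q q' :: "'a \<Rightarrow> real"
  have "\<exists>m\<in>S. \<forall>a\<in>S. below m a \<longrightarrow> a = m"
  proof (rule predicate_Zorn)
    show "partial_order_on S (relation_of below S)"
    proof (rule partial_order_on_relation_ofI)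
      show "below a c" if "below a b" "below b c" for a b c
        using that by (simp add: below_def) (meson order_trans)
      show "a = b" if "below a b" "below b a" for a b
        using that by (auto simp: below_def fun_eq_iff intro: order_antisym)
    qed (simp add: below_def)
    fix C assume C: "C \<in> Chains (relation_of below S)"
    show "\<exists>u\<in>S. \<forall>a\<in>C. below a u"
    proof (cases "C = {}")
      case True
      then show ?thesis using p by (auto simp: S_def)
    next
      case False
      have CS: "sublinear q" "q x \<le> p x" if "q \<in> C" for q x
        using C that by (auto simp: Chains_def relation_of_def S_def)
      have chain: "(\<forall>x. q x \<le> q' x) \<or> (\<forall>x. q' x \<le> q x)" if "q \<in> C" "q' \<in> C" for q q'
        using C that by (auto simp: Chains_def relation_of_def below_def)
      define u where "u x = (INF q\<in>C. q x)" for x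
      have low: "- p (- x) \<le> q x" if "q \<in> C" for q x
        using sublinear_minus[OF CS(1)[OF that], of x] CS(2)[OF that, of "- x"] by simp
      then have bdd: "bdd_below ((\<lambda>q. q x) ` C)" for x
        by (auto intro!: bdd_belowI2)
      have u_le: "u x \<le> q x" if "q \<in> C" for q x
        unfolding u_def by (rule cINF_lower[OF bdd that])
      have u_ge: "c \<le> u x" if "\<And>q. q \<in> C \<Longrightarrow> c \<le> q x" for x c
        unfolding u_def by (rule cINF_greatest[OF False that])
      have "u (x + y) \<le> u x + u y" for x y
      proof -
        have *: "u (x + y) - q' y \<le> q x" if q: "q \<in> C" "q' \<in> C" for q q'
          using chain[OF q]
        proof
          assume "\<forall>x. q x \<le> q' x"
          then show ?thesis
            using u_le[OF q(1), of "x + y"] sublinear_add[OF CS(1)[OF q(1)], of x y]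
            by (smt (verit))
        next
          assume "\<forall>x. q' x \<le> q x"
          then show ?thesis
            using u_le[OF q(2), of "x + y"] sublinear_add[OF CS(1)[OF q(2)], of x y]
            by (smt (verit))
        qed
        have "u (x + y) - q' y \<le> u x" if "q' \<in> C" for q'
          using *[OF _ that] by (rule u_ge)
        then have "u (x + y) - u x \<le> u y"
          by (intro u_ge) (simp add: algebra_simps)
        then show ?thesis by simp
      qed
      moreover have "u (r *\<^sub>R x) \<le> r * u x" if r: "r > 0" for r x
      proof -
        have "u (r *\<^sub>R x) / r \<le> u x"
          using u_le[of _ "r *\<^sub>R x"] sublinear_scaleR[OF CS(1), of _ r x] r
          by (intro u_ge) (auto simp: field_simps)
        then show ?thesis using r by (simp add: field_simps)
      qed
      moreover have "u x \<le> p x" for x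
        using False u_le CS(2) by (meson ex_in_conv order_trans)
      ultimately have "u \<in> S" by (simp add: S_def sublinear_def)
      then show ?thesis using u_le by (auto simp: below_def)
    qed
  qed
  then obtain q where "q \<in> S" "\<And>a. a \<in> S \<Longrightarrow> below q a \<Longrightarrow> a = q" by blast
  then show ?thesis
    by (intro that[of q]) (auto simp: S_def below_def intro: order_trans)
qed

theorem Hahn_Banach_sublinear:
  fixes p :: "'a::real_vector \<Rightarrow> real"
  assumes p: "sublinear p"
  obtains f where "linear f" "\<And>x. f x \<le> p x" "f a = p a"
proof -
  obtain p' where p': "sublinear p'" "\<And>x. p' x \<le> p x" "\<And>x. p' x \<le> p (x + a) - p a"
    using sublinear_shave[OF p] by metis
  obtain f where f: "sublinear f" "\<And>x. f x \<le> p' x"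
    "\<And>q'. sublinear q' \<Longrightarrow> (\<And>x. q' x \<le> f x) \<Longrightarrow> q' = f"
    using minimal_sublinear_exists[OF p'(1)] by metis
  have lin: "linear f"
    by (rule minimal_sublinear_linear[OF f(1) f(3)])
  have "f (- a) \<le> - p a"
    using f(2)[of "- a"] p'(3)[of "- a"] sublinear_zero[OF p] by simp
  then have "p a \<le> f a"
    using linear_neg[OF lin] by simp
  moreover have le: "f x \<le> p x" for x
    using f(2) p'(2) order_trans by blast
  ultimately show ?thesis
    using that[OF lin le] by (simp add: antisym)
qed

section \<open>Rosenthal's disjointification lemma\<close>

lemma infinite_partition:
  fixes K :: "nat set"
  assumes "infinite K"
  obtains N :: "nat \<Rightarrow> nat set"
  where "\<And>p. N p \<subseteq> K" "\<And>p. infinite (N p)" "\<And>p q. p \<noteq> q \<Longrightarrow> N p \<inter> N q = {}"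
proof -
  have bij: "bij_betw (enumerate K) UNIV K"
    using assms by (rule bij_enumerate)
  then have inj: "inj (\<lambda>z. enumerate K (prod_encode z))"
    using inj_compose[OF bij_betw_imp_inj_on[OF bij] inj_prod_encode] by (simp add: comp_def)
  define N where "N p = (\<lambda>i. enumerate K (prod_encode (p, i))) ` UNIV" for p
  show ?thesis
  proof
    show "N p \<subseteq> K" for p
      using bij by (auto simp: N_def bij_betw_def)
    show "infinite (N p)" for p
      unfolding N_def by (intro range_inj_infinite injI) (auto dest: injD[OF inj])
    show "N p \<inter> N q = {}" if "p \<noteq> q" for p q
      unfolding N_def using that by (auto dest: injD[OF inj])
  qed
qed

text \<open>
  If no class \<open>N p\<close> of an infinite partition of \<open>K\<close> will do, each class contains an index \<open>k p\<close> whose row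
  has mass more than \<open>\<delta>\<close> inside its own class. The set of these indices meets every class only once,
  so restricting to it removes that mass from every row. Since all row sums are at most \<open>n * \<delta>\<close>, this
  can happen at most \<open>n\<close> times.
\<close>

lemma Rosenthal_off_diagonal:
  fixes w :: "nat \<Rightarrow> nat \<Rightarrow> real"
  assumes w: "\<And>k j. w k j \<ge> 0"
    and \<delta>: "\<delta> \<ge> 0"
    and K: "infinite K"
    and bound: "\<And>k G. k \<in> K \<Longrightarrow> finite G \<Longrightarrow> G \<subseteq> K - {k} \<Longrightarrow> (\<Sum>j\<in>G. w k j) \<le> real n * \<delta>"
  shows "\<exists>A\<subseteq>K. infinite A \<and> (\<forall>k\<in>A. \<forall>G. finite G \<longrightarrow> G \<subseteq> A - {k} \<longrightarrow> (\<Sum>j\<in>G. w k j) \<le> \<delta>)"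
  using K bound
proof (induction n arbitrary: K)
  case 0
  then show ?case using \<delta> by (intro exI[of _ K]) (auto intro: order_trans)
next
  case (Suc n)
  obtain N :: "nat \<Rightarrow> nat set" where N: "\<And>p. N p \<subseteq> K" "\<And>p. infinite (N p)"
    "\<And>p q. p \<noteq> q \<Longrightarrow> N p \<inter> N q = {}"
    using infinite_partition[OF Suc.prems(1)] by metis
  show ?case
  proof (rule ccontr)
    assume contra: "\<not> ?case"
    have "\<exists>k G. k \<in> N p \<and> finite G \<and> G \<subseteq> N p - {k} \<and> \<delta> < (\<Sum>j\<in>G. w k j)" for p
    proof -
      have "\<not> (\<forall>k\<in>N p. \<forall>G. finite G \<longrightarrow> G \<subseteq> N p - {k} \<longrightarrow> (\<Sum>j\<in>G. w k j) \<le> \<delta>)"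
      proof
        assume "\<forall>k\<in>N p. \<forall>G. finite G \<longrightarrow> G \<subseteq> N p - {k} \<longrightarrow> (\<Sum>j\<in>G. w k j) \<le> \<delta>"
        then have ?case using N(1,2)[of p] by (intro exI[of _ "N p"] conjI)
        with contra show False by contradiction
      qed
      then show ?thesis by (auto simp: not_le)
    qed
    then obtain k where "\<forall>p. \<exists>G. k p \<in> N p \<and> finite G \<and> G \<subseteq> N p - {k p} \<and> \<delta> < (\<Sum>j\<in>G. w (k p) j)"
      using choice[of "\<lambda>p k. \<exists>G. k \<in> N p \<and> finite G \<and> G \<subseteq> N p - {k} \<and> \<delta> < (\<Sum>j\<in>G. w k j)"]
      by blast
    from choice[OF this] obtain G where kG: "\<And>p. k p \<in> N p" "\<And>p. finite (G p)" "\<And>p. G p \<subseteq> N p - {k p}"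
      "\<And>p. \<delta> < (\<Sum>j\<in>G p. w (k p) j)"
      by blast
    have kN: "k q \<notin> N p" if "q \<noteq> p" for p q
      using kG(1)[of q] N(3)[OF that] by blast
    have "inj k"
      using kG(1) kN by (metis injI)
    then have inf: "infinite (range k)"
      by (rule range_inj_infinite)
    have "\<exists>A\<subseteq>range k. infinite A \<and>
        (\<forall>k\<in>A. \<forall>G. finite G \<longrightarrow> G \<subseteq> A - {k} \<longrightarrow> (\<Sum>j\<in>G. w k j) \<le> \<delta>)"
    proof (rule Suc.IH[OF inf])
      fix l H assume "l \<in> range k" and H: "finite H" "H \<subseteq> range k - {l}"
      then obtain p where l: "l = k p" by auto
      have disj: "H \<inter> G p = {}"
      proof (rule ccontr)
        assume "H \<inter> G p \<noteq> {}"
        then obtain q where "k q \<in> G p" "k q \<noteq> k p" using H(2) l by auto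
        then show False using kG(3)[of p] kN[of q p] by (cases "q = p") auto
      qed
      have sub: "H \<union> G p \<subseteq> K - {k p}"
      proof -
        have "H \<subseteq> K - {k p}" using H(2) kG(1) N(1) l by auto
        moreover have "G p \<subseteq> K - {k p}" using kG(3)[of p] N(1)[of p] by auto
        ultimately show ?thesis by simp
      qed
      have "k p \<in> K" using kG(1) N(1) by blast
      from Suc.prems(2)[OF this _ sub] H(1) kG(2)
      have "(\<Sum>j\<in>H \<union> G p. w (k p) j) \<le> real (Suc n) * \<delta>" by simp
      then have "(\<Sum>j\<in>H. w (k p) j) + (\<Sum>j\<in>G p. w (k p) j) \<le> real (Suc n) * \<delta>"
        using disj H(1) kG(2) by (simp add: sum.union_disjoint)
      then show "(\<Sum>j\<in>H. w l j) \<le> real n * \<delta>"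
        using kG(4)[of p] l by (simp add: algebra_simps)
    qed
    moreover have "range k \<subseteq> K" using kG(1) N(1) by blast
    ultimately show False using contra by (meson subset_trans)
  qed
qed

section \<open>Norming and annihilating functionals over either scalar field\<close>

text \<open>
  Two seminorms matter: the norm, for which the assumption yields norming functionals, and the
  distance to a subspace, for which it yields functionals that vanish on the subspace. The factor 2
  leaves room for a simple passage from real to complex functionals. The class
  \<open>euclidean_space\<close> makes a family of scalars with bounded finite sums absolutely summable.
\<close>

locale enough_functionals = banach_over sc
  for sc :: "'k::{real_normed_field,euclidean_space} \<Rightarrow> 'a::banach \<Rightarrow> 'a" +
  assumes seminorm_functional:
    "(\<And>x y. p (x + y) \<le> p x + p y) \<Longrightarrow> (\<And>c x. p (sc c x) = norm c * p x) \<Longrightarrow>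
     (\<And>x. p x \<le> norm x) \<Longrightarrow> \<exists>\<phi>\<in>dual sc. (\<forall>x. norm (\<phi> x) \<le> 2 * p x) \<and> p a \<le> norm (\<phi> a)"

lemma (in banach_over) sublinear_seminorm:
  assumes "\<And>x y. p (x + y) \<le> p x + p y" "\<And>c x. p (sc c x) = norm c * p x"
  shows "sublinear p"
  using assms(1) assms(2)[of "of_real _"] by (simp add: sublinear_def scale_of_real)

lemma enough_functionals_real: "enough_functionals ((*\<^sub>R) :: real \<Rightarrow> 'a::banach \<Rightarrow> 'a)"
proof -
  interpret banach_over "(*\<^sub>R) :: real \<Rightarrow> 'a \<Rightarrow> 'a" by (rule banach_over_scaleR)
  show ?thesis
  proof
    fix p :: "'a \<Rightarrow> real" and a
    assume p: "\<And>x y. p (x + y) \<le> p x + p y" "\<And>c x. p (c *\<^sub>R x) = norm c * p x"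
      "\<And>x. p x \<le> norm x"
    obtain f where f: "linear f" "\<And>x. f x \<le> p x" "f a = p a"
      using Hahn_Banach_sublinear[OF sublinear_seminorm, of p a] p(1,2) by blast
    have abs: "\<bar>f x\<bar> \<le> p x" for x
      using f(2)[of x] f(2)[of "- x"] p(2)[of "- 1" x] linear_neg[OF f(1), of x] by simp
    then have p0: "0 \<le> p x" for x
      using abs_ge_zero order_trans by blast
    have "bounded_linear f"
      using f(1) abs p(3) by (intro bounded_linear_intro[where K = 1])
        (auto simp: linear_add linear_scale intro: order_trans)
    then have "f \<in> dual (*\<^sub>R)"
      using linear_scale[OF f(1)] by (simp add: dual_def)
    moreover have "norm (f x) \<le> 2 * p x" for x
      using abs[of x] p0[of x] by simp
    ultimately show "\<exists>\<phi>\<in>dual (*\<^sub>R). (\<forall>x. norm (\<phi> x) \<le> 2 * p x) \<and> p a \<le> norm (\<phi> a)"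
      using f(3) by (intro bexI[of _ f]) auto
  qed
qed

text \<open>
  A real functional \<open>f\<close> is the real part of the complex one \<open>x \<mapsto> f x - \<i> f (\<i> x)\<close>. Estimating the
  real and the imaginary part separately costs the factor 2 allowed in the locale assumption.
\<close>

lemma enough_functionals_complex:
  assumes "banach_over (cs :: complex \<Rightarrow> 'a::banach \<Rightarrow> 'a)"
  shows "enough_functionals cs"
proof -
  interpret banach_over cs by (rule assms)
  show ?thesis
  proof
    fix p :: "'a \<Rightarrow> real" and a
    assume p: "\<And>x y. p (x + y) \<le> p x + p y" "\<And>c x. p (cs c x) = norm c * p x"
      "\<And>x. p x \<le> norm x"
    obtain f where f: "linear f" "\<And>x. f x \<le> p x" "f a = p a"
      using Hahn_Banach_sublinear[OF sublinear_seminorm, of p a] p(1,2) by blast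
    have abs: "\<bar>f x\<bar> \<le> p x" for x
      using f(2)[of x] f(2)[of "- x"] p(2)[of "- 1" x] linear_neg[OF f(1), of x]
        scale_of_real[of "- 1" x] by simp
    then have p0: "0 \<le> p x" for x
      using abs_ge_zero order_trans by blast
    define \<phi> where "\<phi> x = Complex (f x) (- f (cs \<i> x))" for x
    have split: "cs c x = Re c *\<^sub>R x + Im c *\<^sub>R cs \<i> x" for c x
    proof -
      have "cs c x = cs (of_real (Re c) + of_real (Im c) * \<i>) x"
        by (simp add: complex_eq mult.commute)
      also have "\<dots> = Re c *\<^sub>R x + Im c *\<^sub>R cs \<i> x"
        by (simp only: scale_left_distrib scale_scale[symmetric] scale_of_real)
      finally show ?thesis .
    qed
    have f_scale: "f (cs c x) = Re c * f x + Im c * f (cs \<i> x)" for c x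
      using f(1) by (simp add: split[of c x] linear_add linear_scale)
    have \<phi>_scale: "\<phi> (cs c x) = c * \<phi> x" for c x
      using f_scale[of c x] f_scale[of "\<i> * c" x]
      by (simp add: \<phi>_def complex_eq_iff)
    have \<phi>_add: "\<phi> (x + y) = \<phi> x + \<phi> y" for x y
      using f(1) by (simp add: \<phi>_def complex_eq_iff scale_right_distrib linear_add)
    have bound: "norm (\<phi> x) \<le> 2 * p x" for x
    proof -
      have "norm (\<phi> x) \<le> \<bar>f x\<bar> + \<bar>f (cs \<i> x)\<bar>"
        using cmod_le[of "\<phi> x"] by (simp add: \<phi>_def)
      also have "\<dots> \<le> p x + p (cs \<i> x)" using abs by (intro add_mono)
      finally show ?thesis using p(2)[of \<i> x] by simp
    qed
    have "bounded_linear \<phi>"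
    proof (rule bounded_linear_intro[where K = 2])
      show "\<phi> (r *\<^sub>R x) = r *\<^sub>R \<phi> x" for r x
        using \<phi>_scale[of "of_real r" x] by (simp add: scale_of_real scaleR_conv_of_real)
      show "norm (\<phi> x) \<le> norm x * 2" for x
        using bound[of x] p(3)[of x] by simp
    qed (rule \<phi>_add)
    then have "\<phi> \<in> dual cs" using \<phi>_scale by (simp add: dual_def)
    moreover have "p a \<le> norm (\<phi> a)"
      using abs_Re_le_cmod[of "\<phi> a"] f(3) by (simp add: \<phi>_def)
    ultimately show "\<exists>\<phi>\<in>dual cs. (\<forall>x. norm (\<phi> x) \<le> 2 * p x) \<and> p a \<le> norm (\<phi> a)"
      using bound by blast
  qed
qed

context enough_functionals
begin

lemma norming_functional:
  obtains \<phi> where "\<phi> \<in> dual sc" "\<And>x. norm (\<phi> x) \<le> 2 * norm x" "norm a \<le> norm (\<phi> a)"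
  using seminorm_functional[of norm a, OF norm_triangle_ineq norm_scale order_refl] by blast

lemma dual_add: "\<phi> \<in> dual sc \<Longrightarrow> \<phi> (x + y) = \<phi> x + \<phi> y"
  by (simp add: dual_def bounded_linear.linear linear_add)

lemma dual_diff: "\<phi> \<in> dual sc \<Longrightarrow> \<phi> (x - y) = \<phi> x - \<phi> y"
  by (simp add: dual_def bounded_linear.linear linear_diff)

lemma dual_sum: "\<phi> \<in> dual sc \<Longrightarrow> \<phi> (\<Sum>i\<in>G. x i) = (\<Sum>i\<in>G. \<phi> (x i))"
  by (simp add: dual_def bounded_linear.linear linear_sum)

lemma dual_scale: "\<phi> \<in> dual sc \<Longrightarrow> \<phi> (sc c x) = c * \<phi> x"
  by (simp add: dual_def)

lemma dual_tendsto: "\<phi> \<in> dual sc \<Longrightarrow> (x \<longlongrightarrow> a) F \<Longrightarrow> ((\<lambda>n. \<phi> (x n)) \<longlongrightarrow> \<phi> a) F"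
  by (simp add: dual_def bounded_linear.tendsto)

lemma bounded_linear_scale: "bounded_linear (sc c)"
proof (rule bounded_linear_intro[where K = "norm c"])
  show "sc c (r *\<^sub>R x) = r *\<^sub>R sc c x" for r x
    using scale_left_commute[of c "of_real r" x] by (simp only: scale_of_real)
qed (simp_all add: scale_right_distrib norm_scale mult.commute)

section \<open>Series with bounded finite sums\<close>

lemma functional_abs_sum_le:
  assumes \<phi>: "\<phi> \<in> dual sc" "\<And>v. norm (\<phi> v) \<le> \<kappa> * norm v" "\<kappa> \<ge> 0"
    and sums: "\<And>A. finite A \<Longrightarrow> norm (\<Sum>i\<in>A. x i) \<le> C"
    and G: "finite G"
  shows "(\<Sum>i\<in>G. norm (\<phi> (x i))) \<le> 2 * real DIM('k) * (\<kappa> * C)"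
proof (rule sum_norm_allsubsets_bound[OF G])
  fix Q assume "Q \<subseteq> G"
  then have "norm (\<Sum>i\<in>Q. x i) \<le> C"
    using G by (intro sums) (rule finite_subset)
  then have "\<kappa> * norm (\<Sum>i\<in>Q. x i) \<le> \<kappa> * C"
    using \<phi>(3) by (rule mult_left_mono)
  then show "norm (\<Sum>i\<in>Q. \<phi> (x i)) \<le> \<kappa> * C"
    using \<phi>(2)[of "\<Sum>i\<in>Q. x i"] by (simp add: dual_sum[OF \<phi>(1)])
qed

text \<open>A functional that norms the combination reduces the estimate to the absolute sum of its values
  on the terms.\<close>

lemma norm_combination_le:
  assumes sums: "\<And>A. finite A \<Longrightarrow> norm (\<Sum>i\<in>A. x i) \<le> C"
    and G: "finite G" and d: "\<And>j. j \<in> G \<Longrightarrow> norm (d j) \<le> m" and m: "m \<ge> 0"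
  shows "norm (\<Sum>j\<in>G. sc (d j) (x j)) \<le> m * (2 * real DIM('k) * (2 * C))"
proof -
  obtain \<phi> where \<phi>: "\<phi> \<in> dual sc" "\<And>v. norm (\<phi> v) \<le> 2 * norm v"
    and le: "norm (\<Sum>j\<in>G. sc (d j) (x j)) \<le> norm (\<phi> (\<Sum>j\<in>G. sc (d j) (x j)))"
    using norming_functional[of "\<Sum>j\<in>G. sc (d j) (x j)"] by metis
  note le
  also have "norm (\<phi> (\<Sum>j\<in>G. sc (d j) (x j))) = norm (\<Sum>j\<in>G. d j * \<phi> (x j))"
    by (simp add: dual_sum[OF \<phi>(1)] dual_scale[OF \<phi>(1)])
  also have "\<dots> \<le> (\<Sum>j\<in>G. norm (d j * \<phi> (x j)))"
    by (rule norm_sum)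
  also have "\<dots> \<le> (\<Sum>j\<in>G. m * norm (\<phi> (x j)))"
    using d by (intro sum_mono) (simp add: norm_mult mult_right_mono)
  also have "\<dots> = m * (\<Sum>j\<in>G. norm (\<phi> (x j)))"
    by (simp add: sum_distrib_left)
  also have "\<dots> \<le> m * (2 * real DIM('k) * (2 * C))"
    using functional_abs_sum_le[OF \<phi> _ sums G] m by (intro mult_left_mono) auto
  finally show ?thesis .
qed

section \<open>Copies of the space of null sequences\<close>

lemma c0_le_norm: "a \<in> c0 \<Longrightarrow> norm (a k) \<le> c0_norm a"
  unfolding c0_norm_def
proof (intro cSUP_upper)
  assume "a \<in> c0"
  then have "bounded (range a)"
    by (auto simp: c0_def intro: convergent_imp_bounded)
  then show "bdd_above (range (\<lambda>n. norm (a n)))"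
    by (auto simp: bounded_iff intro: bdd_aboveI2)
qed simp

text \<open>The two estimates say that the vectors \<open>z j\<close> behave like the unit vectors of \<open>c0\<close>, so
  \<open>a \<mapsto> \<Sum> sc (a j) (z j)\<close> is an embedding; the upper estimate on late blocks of indices makes the
  series converge.\<close>

lemma contains_c0I:
  fixes z :: "nat \<Rightarrow> 'a"
  assumes upper: "\<And>d G m. finite G \<Longrightarrow> (\<And>j. j \<in> G \<Longrightarrow> norm (d j) \<le> m) \<Longrightarrow> m \<ge> 0 \<Longrightarrow>
      norm (\<Sum>j\<in>G. sc (d j) (z j)) \<le> m * B"
    and lower: "\<And>d G k. finite G \<Longrightarrow> k \<in> G \<Longrightarrow> c * norm (d k) \<le> norm (\<Sum>j\<in>G. sc (d j) (z j))"
    and c: "c > 0"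
  shows "contains_c0 sc"
proof -
  define T where "T a = (\<Sum>j. sc (a j) (z j))" for a
  have summ: "summable (\<lambda>j. sc (a j) (z j))" if a: "a \<in> c0" for a
    unfolding summable_Cauchy
  proof (intro allI impI)
    fix e :: real assume e: "e > 0"
    define m where "m = e / (\<bar>B\<bar> + 1)"
    have m: "m > 0" using e by (simp add: m_def)
    have "m * B < e"
    proof -
      have "m * B \<le> m * \<bar>B\<bar>" using m by (intro mult_left_mono) auto
      also have "\<dots> < m * (\<bar>B\<bar> + 1)" using m by simp
      also have "\<dots> = e" by (simp add: m_def)
      finally show ?thesis .
    qed
    obtain M where M: "\<And>j. j \<ge> M \<Longrightarrow> norm (a j) < m"
      using a m LIMSEQ_D[of a 0 m] unfolding c0_def by auto
    have "norm (\<Sum>j=p..<n. sc (a j) (z j)) < e" if "p \<ge> M" for p n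
    proof -
      have "norm (\<Sum>j=p..<n. sc (a j) (z j)) \<le> m * B"
        using M that m by (intro upper) (auto intro: less_imp_le)
      then show ?thesis using \<open>m * B < e\<close> by simp
    qed
    then show "\<exists>N. \<forall>m\<ge>N. \<forall>n. norm (\<Sum>j=m..<n. sc (a j) (z j)) < e" by blast
  qed
  have lim: "(\<lambda>n. norm (\<Sum>j<n. sc (a j) (z j))) \<longlonglongrightarrow> norm (T a)" if "a \<in> c0" for a
    unfolding T_def by (intro tendsto_norm summable_LIMSEQ summ that)
  have c0_add: "(\<lambda>n. a n + b n) \<in> c0" if "a \<in> c0" "b \<in> c0" for a b :: "nat \<Rightarrow> 'k"
    using that tendsto_add[of a 0 sequentially b 0] by (simp add: c0_def)
  have c0_scale: "(\<lambda>n. s * a n) \<in> c0" if "a \<in> c0" for a :: "nat \<Rightarrow> 'k" and s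
    using that tendsto_mult_left[of a 0 sequentially s] by (simp add: c0_def)
  have T_add: "T (\<lambda>n. a n + b n) = T a + T b" if "a \<in> c0" "b \<in> c0" for a b
    unfolding T_def using suminf_add[OF summ[OF that(1)] summ[OF that(2)]]
    by (simp add: scale_left_distrib)
  have T_scale: "T (\<lambda>n. s * a n) = sc s (T a)" if "a \<in> c0" for a s
    unfolding T_def using bounded_linear.suminf[OF bounded_linear_scale summ[OF that], of s]
    by (simp add: scale_scale)
  have T_upper: "norm (T a) \<le> B * c0_norm a" if a: "a \<in> c0" for a
  proof (rule LIMSEQ_le_const2[OF lim[OF a]], intro exI allI impI)
    fix n
    have "0 \<le> c0_norm a" using c0_le_norm[OF a, of 0] norm_ge_zero order_trans by blast
    then have "norm (\<Sum>j<n. sc (a j) (z j)) \<le> c0_norm a * B"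
      using c0_le_norm[OF a] by (intro upper) auto
    then show "norm (\<Sum>j<n. sc (a j) (z j)) \<le> B * c0_norm a" by (simp add: mult.commute)
  qed
  have T_lower: "norm (a k) \<le> inverse c * norm (T a)" if a: "a \<in> c0" for a k
  proof -
    have "c * norm (a k) \<le> norm (T a)"
    proof (rule LIMSEQ_le_const[OF lim[OF a]], intro exI allI impI)
      fix n assume "n \<ge> Suc k"
      then show "c * norm (a k) \<le> norm (\<Sum>j<n. sc (a j) (z j))"
        by (intro lower) auto
    qed
    then show ?thesis using c by (simp add: field_simps)
  qed
  have "inj_on T c0"
  proof (rule inj_onI)
    fix a b assume ab: "a \<in> c0" "b \<in> c0" "T a = T b"
    have d: "(\<lambda>n. a n + (- 1) * b n) \<in> c0"
      by (rule c0_add[OF ab(1) c0_scale[OF ab(2)]])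
    have "T (\<lambda>n. a n + (- 1) * b n) = T a + sc (- 1) (T b)"
      by (simp only: T_add[OF ab(1) c0_scale[OF ab(2)]] T_scale[OF ab(2)])
    then have "T (\<lambda>n. a n + (- 1) * b n) = 0" using ab(3) by simp
    then have "norm (a k + (- 1) * b k) \<le> 0" for k
      using T_lower[OF d, of k] by simp
    then show "a = b" by (intro ext) (simp add: algebra_simps)
  qed
  then have "bij_betw T c0 (T ` c0)" by (rule inj_on_imp_bij_betw)
  moreover have "subspace (T ` c0)"
  proof (rule subspaceI)
    have "T (\<lambda>n. 0) = 0" by (simp add: T_def)
    moreover have "(\<lambda>n. 0) \<in> c0" by (simp add: c0_def)
    ultimately show "0 \<in> T ` c0" by (metis imageI)
  next
    fix u v assume "u \<in> T ` c0" "v \<in> T ` c0"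
    then show "u + v \<in> T ` c0" using c0_add T_add by (force simp flip: T_add)
  next
    fix s u assume "u \<in> T ` c0"
    then show "sc s u \<in> T ` c0" using c0_scale T_scale by (force simp flip: T_scale)
  qed
  moreover have "c0_norm a \<le> inverse c * norm (T a)" if "a \<in> c0" for a
    unfolding c0_norm_def using T_lower[OF that] by (intro cSUP_least) auto
  ultimately show ?thesis
    unfolding contains_c0_def using T_add T_scale T_upper
    by (intro exI[of _ "T ` c0"] exI[of _ T] conjI) blast+
qed

section \<open>Approximation from a subspace\<close>

lemma infdist_near:
  assumes "S \<noteq> {}" "e > 0"
  shows "\<exists>u\<in>S. norm (v - u) < infdist v S + e"
proof (rule ccontr)
  assume "\<not> ?thesis"
  then have "infdist v S + e \<le> infdist v S"
    unfolding infdist_notempty[OF assms(1)]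
    by (intro cINF_greatest assms(1)) (auto simp: not_less dist_norm)
  then show False using assms(2) by simp
qed

lemma infdist_subspace_add:
  assumes S: "subspace S"
  shows "infdist (u + v) S \<le> infdist u S + infdist v S"
proof (rule field_le_epsilon)
  have ne: "S \<noteq> {}" using subspace_0[OF S] by blast
  fix e :: real assume "e > 0"
  then have e: "e / 2 > 0" by simp
  obtain u' where u': "u' \<in> S" "norm (u - u') < infdist u S + e / 2"
    using infdist_near[OF ne e] by blast
  obtain v' where v': "v' \<in> S" "norm (v - v') < infdist v S + e / 2"
    using infdist_near[OF ne e] by blast
  have "infdist (u + v) S \<le> dist (u + v) (u' + v')"
    using u'(1) v'(1) by (intro infdist_le subspace_add[OF S])
  also have "\<dots> \<le> norm (u - u') + norm (v - v')"
    using dist_triangle_add[of u v u' v'] by (simp add: dist_norm)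
  finally show "infdist (u + v) S \<le> infdist u S + infdist v S + e"
    using u'(2) v'(2) by simp
qed

lemma infdist_subspace_scale:
  assumes S: "subspace S"
  shows "infdist (sc c v) S = norm c * infdist v S"
proof -
  have ne: "S \<noteq> {}" using subspace_0[OF S] by blast
  have scale_le: "infdist (sc c v) S \<le> norm c * infdist v S" if c: "c \<noteq> 0" for c v
  proof (rule field_le_epsilon)
    fix e :: real assume "e > 0"
    then have e: "e / norm c > 0" using c by simp
    obtain v' where v': "v' \<in> S" "norm (v - v') < infdist v S + e / norm c"
      using infdist_near[OF ne e] by blast
    have "infdist (sc c v) S \<le> dist (sc c v) (sc c v')"
      using v'(1) by (intro infdist_le subspace_scale[OF S])
    also have "\<dots> = norm c * norm (v - v')"
      by (simp add: dist_norm norm_scale flip: scale_right_diff_distrib)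
    also have "\<dots> \<le> norm c * (infdist v S + e / norm c)"
      using v'(2) by (intro mult_left_mono) auto
    finally show "infdist (sc c v) S \<le> norm c * infdist v S + e"
      using c by (simp add: distrib_left)
  qed
  show ?thesis
  proof (cases "c = 0")
    case True
    then show ?thesis using subspace_0[OF S] by simp
  next
    case False
    have "infdist v S \<le> inverse (norm c) * infdist (sc c v) S"
      using scale_le[of "inverse c" "sc c v"] False by (simp add: norm_inverse)
    then have "norm c * infdist v S \<le> infdist (sc c v) S"
      using False by (simp add: field_simps)
    then show ?thesis using scale_le[OF False, of v] by simp
  qed
qed

text \<open>The distance to \<open>S\<close> is a seminorm that vanishes on \<open>S\<close>. A functional dominated by it
  vanishes on \<open>S\<close>, hence at \<open>w\<close>, where it is at least as large as the distance.\<close>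

lemma approximable_if_annihilated:
  assumes S: "subspace S"
    and ann: "\<forall>\<psi>\<in>dual sc. (\<forall>u\<in>S. \<psi> u = 0) \<longrightarrow> \<psi> w = 0"
    and e: "e > 0"
  obtains u where "u \<in> S" "norm (w - u) < e"
proof -
  have "infdist v S \<le> norm v" for v
    using infdist_le[OF subspace_0[OF S], of v] by simp
  then obtain \<psi> where \<psi>: "\<psi> \<in> dual sc" "\<And>v. norm (\<psi> v) \<le> 2 * infdist v S"
    "infdist w S \<le> norm (\<psi> w)"
    using seminorm_functional[of "\<lambda>v. infdist v S" w,
        OF infdist_subspace_add[OF S] infdist_subspace_scale[OF S]] by blast
  have "\<psi> u = 0" if "u \<in> S" for u
    using \<psi>(2)[of u] that by simp
  then have "\<psi> w = 0" using ann \<psi>(1) by blast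
  then have "infdist w S = 0"
    using \<psi>(3) infdist_nonneg[of w S] by simp
  moreover have "S \<noteq> {}" using subspace_0[OF S] by blast
  ultimately show ?thesis
    using infdist_near[of S e w] e that by auto
qed

lemma span_sequence:
  assumes "u \<in> span (range z)"
  obtains c and n :: nat where "u = (\<Sum>j<n. sc (c j) (z j))"
proof -
  have "\<exists>c n. u = (\<Sum>j<n::nat. sc (c j) (z j))"
    using assms
  proof (induction rule: span_induct_alt)
    case base
    show ?case by (intro exI[of _ "\<lambda>_. 0"] exI[of _ 0]) simp
  next
    case (step s v y)
    then obtain i where v: "v = z i" by auto
    from step obtain c n where y: "y = (\<Sum>j<n. sc (c j) (z j))" by blast
    define c' where "c' j = (if j < n then c j else 0) + (if j = i then s else 0)" for j
    define N where "N = max n (Suc i)"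
    have "(\<Sum>j<N. sc (c' j) (z j)) =
        (\<Sum>j<N. if j < n then sc (c j) (z j) else 0) + (\<Sum>j<N. if j = i then sc s (z j) else 0)"
      unfolding sum.distrib[symmetric]
      by (rule sum.cong) (auto simp: c'_def scale_left_distrib)
    also have "(\<Sum>j<N. if j = i then sc s (z j) else 0) = sc s v"
      by (simp add: v N_def less_max_iff_disj)
    also have "(\<Sum>j<N. if j < n then sc (c j) (z j) else 0) = y"
      unfolding y by (rule sum.mono_neutral_cong_right) (auto simp: N_def)
    finally have "sc s v + y = (\<Sum>j<N. sc (c' j) (z j))" by (simp add: add.commute)
    then show ?case by blast
  qed
  then show ?thesis using that by blast
qed

section \<open>The Bessaga-Pelczynski and Orlicz-Pettis arguments\<close>

context
  fixes x :: "nat \<Rightarrow> 'a" and C \<epsilon> :: real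
  assumes sums: "\<And>A. finite A \<Longrightarrow> norm (\<Sum>i\<in>A. x i) \<le> C"
    and x: "\<And>n. \<epsilon> \<le> norm (x n)" and \<epsilon>: "\<epsilon> > 0"
begin

text \<open>
  Choose functionals \<open>\<psi> n\<close> that norm the terms. The rows of the matrix \<open>norm (\<psi> k (x j))\<close> have
  uniformly bounded sums, so by Rosenthal's lemma its entries off the diagonal sum to at most
  \<open>\<epsilon> / 2\<close> in each row of an infinite submatrix. The diagonal entries are at least \<open>\<epsilon>\<close>; hence the term
  with the largest coefficient cannot be cancelled by the others.
\<close>

lemma dominant_coefficient_subsequence:
  shows "\<exists>(r :: nat \<Rightarrow> nat) \<phi>. strict_mono r \<and>
    (\<forall>k. \<phi> k \<in> dual sc) \<and> (\<forall>k v. norm (\<phi> k v) \<le> 2 * norm v) \<and>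
    (\<forall>k d G. finite G \<longrightarrow> k \<in> G \<longrightarrow> (\<forall>j\<in>G. norm (d j) \<le> norm (d k)) \<longrightarrow>
       \<epsilon> / 2 * norm (d k) \<le> norm (\<phi> k (\<Sum>j\<in>G. sc (d j) (x (r j)))))"
proof -
  have "\<exists>\<phi>. \<phi> \<in> dual sc \<and> (\<forall>v. norm (\<phi> v) \<le> 2 * norm v) \<and> norm (x n) \<le> norm (\<phi> (x n))" for n
    using norming_functional[of "x n"] by metis
  then obtain \<psi> where \<psi>: "\<And>n. \<psi> n \<in> dual sc" "\<And>n v. norm (\<psi> n v) \<le> 2 * norm v"
    "\<And>n. norm (x n) \<le> norm (\<psi> n (x n))"
    by metis
  obtain N :: nat where N: "2 * real DIM('k) * (2 * C) \<le> real N * (\<epsilon> / 2)"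
  proof -
    obtain N :: nat where "2 * real DIM('k) * (2 * C) / (\<epsilon> / 2) \<le> real N"
      using real_arch_simple by blast
    then show ?thesis using \<epsilon> that[of N] by (simp add: field_simps)
  qed
  have "\<exists>A\<subseteq>UNIV. infinite A \<and> (\<forall>k\<in>A. \<forall>G. finite G \<longrightarrow> G \<subseteq> A - {k} \<longrightarrow>
      (\<Sum>j\<in>G. norm (\<psi> k (x j))) \<le> \<epsilon> / 2)"
  proof (rule Rosenthal_off_diagonal)
    show "(\<Sum>j\<in>G. norm (\<psi> k (x j))) \<le> real N * (\<epsilon> / 2)" if "finite G" for k G
      using functional_abs_sum_le[OF \<psi>(1,2) _ sums that, of k] N by simp
  qed (use \<epsilon> in auto)
  then obtain A where A: "infinite A" and "\<forall>k\<in>A. \<forall>G. finite G \<longrightarrow> G \<subseteq> A - {k} \<longrightarrow>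
      (\<Sum>j\<in>G. norm (\<psi> k (x j))) \<le> \<epsilon> / 2"
    by (elim exE conjE)
  then have off_diagonal: "(\<Sum>j\<in>G. norm (\<psi> k (x j))) \<le> \<epsilon> / 2"
    if "k \<in> A" "finite G" "G \<subseteq> A - {k}" for k G
    using that by simp
  define r where "r = enumerate A"
  have r: "strict_mono r"
    unfolding r_def using A by (rule strict_mono_enumerate)
  have rA: "r k \<in> A" for k
    unfolding r_def using A by (rule enumerate_in_set)
  have "\<epsilon> / 2 * norm (d k) \<le> norm (\<psi> (r k) (\<Sum>j\<in>G. sc (d j) (x (r j))))"
    if G: "finite G" "k \<in> G" and d: "\<forall>j\<in>G. norm (d j) \<le> norm (d k)" for k d G
  proof -
    let ?\<psi> = "\<psi> (r k)"
    have inj: "inj_on r (G - {k})"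
      using strict_mono_imp_inj_on[OF r] by (rule inj_on_subset) (rule subset_UNIV)
    have "norm (\<Sum>j\<in>G - {k}. d j * ?\<psi> (x (r j))) \<le> (\<Sum>j\<in>G - {k}. norm (d j * ?\<psi> (x (r j))))"
      by (rule norm_sum)
    also have "\<dots> \<le> (\<Sum>j\<in>G - {k}. norm (d k) * norm (?\<psi> (x (r j))))"
      using d by (intro sum_mono) (simp add: norm_mult mult_right_mono)
    also have "\<dots> = norm (d k) * (\<Sum>j\<in>r ` (G - {k}). norm (?\<psi> (x j)))"
      by (simp add: sum_distrib_left sum.reindex[OF inj])
    also have "\<dots> \<le> norm (d k) * (\<epsilon> / 2)"
    proof (intro mult_left_mono off_diagonal rA)
      show "r ` (G - {k}) \<subseteq> A - {r k}"
        using rA r by (auto simp: strict_mono_eq)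
    qed (use G in auto)
    finally have off: "norm (\<Sum>j\<in>G - {k}. d j * ?\<psi> (x (r j))) \<le> norm (d k) * (\<epsilon> / 2)" .
    have "norm (d k) * \<epsilon> \<le> norm (d k * ?\<psi> (x (r k)))"
      using x[of "r k"] \<psi>(3)[of "r k"] by (simp add: norm_mult mult_left_mono)
    moreover have "?\<psi> (\<Sum>j\<in>G. sc (d j) (x (r j))) =
        d k * ?\<psi> (x (r k)) + (\<Sum>j\<in>G - {k}. d j * ?\<psi> (x (r j)))"
      using G by (simp add: dual_sum[OF \<psi>(1)] dual_scale[OF \<psi>(1)] dual_add[OF \<psi>(1)] sum.remove)
    moreover have "norm (d k * ?\<psi> (x (r k))) - norm (\<Sum>j\<in>G - {k}. d j * ?\<psi> (x (r j)))
        \<le> norm (d k * ?\<psi> (x (r k)) + (\<Sum>j\<in>G - {k}. d j * ?\<psi> (x (r j))))"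
      by (rule norm_diff_ineq)
    ultimately show ?thesis
      using off by (simp add: field_simps)
  qed
  then show ?thesis
    using r \<psi>(1,2) by (intro exI[of _ r] exI[of _ "\<lambda>k. \<psi> (r k)"] conjI allI impI)
qed

theorem Bessaga_Pelczynski:
  shows "contains_c0 sc"
proof -
  obtain r :: "nat \<Rightarrow> nat" and \<phi> where r: "strict_mono r" and \<phi>_dual: "\<forall>k. \<phi> k \<in> dual sc"
    and \<phi>_norm: "\<forall>k v. norm (\<phi> k v) \<le> 2 * norm v"
    and dom: "\<forall>k d G. finite G \<longrightarrow> k \<in> G \<longrightarrow> (\<forall>j\<in>G. norm (d j) \<le> norm (d k)) \<longrightarrow>
       \<epsilon> / 2 * norm (d k) \<le> norm (\<phi> k (\<Sum>j\<in>G. sc (d j) (x (r j))))"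
    using dominant_coefficient_subsequence by (elim exE conjE)
  note \<phi> = \<phi>_dual[rule_format] \<phi>_norm[rule_format]
  have sums_r: "norm (\<Sum>i\<in>A. x (r i)) \<le> C" if "finite A" for A
  proof -
    have "inj_on r A" using strict_mono_imp_inj_on[OF r] by (rule inj_on_subset) (rule subset_UNIV)
    then have "(\<Sum>i\<in>A. x (r i)) = (\<Sum>i\<in>r ` A. x i)" by (simp add: sum.reindex)
    then show ?thesis using sums[of "r ` A"] that by simp
  qed
  show ?thesis
  proof (rule contains_c0I[of "\<lambda>j. x (r j)"])
    show "norm (\<Sum>j\<in>G. sc (d j) (x (r j))) \<le> m * (2 * real DIM('k) * (2 * C))"
      if "finite G" "\<And>j. j \<in> G \<Longrightarrow> norm (d j) \<le> m" "m \<ge> 0" for d G m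
      by (rule norm_combination_le[OF sums_r that])
    show "\<epsilon> / 4 * norm (d k) \<le> norm (\<Sum>j\<in>G. sc (d j) (x (r j)))"
      if G: "finite G" "k \<in> G" for d G k
    proof -
      \<comment> \<open>Compare with the largest coefficient, which is the one that the functionals detect; their
        norm, at most 2, turns \<open>\<epsilon> / 2\<close> into \<open>\<epsilon> / 4\<close>.\<close>
      have "Max ((\<lambda>j. norm (d j)) ` G) \<in> (\<lambda>j. norm (d j)) ` G"
        using G by (intro Max_in) auto
      then obtain l where l: "l \<in> G" "norm (d l) = Max ((\<lambda>j. norm (d j)) ` G)" by auto
      then have max: "\<forall>j\<in>G. norm (d j) \<le> norm (d l)" using G by simp
      have "\<epsilon> / 4 * norm (d k) \<le> \<epsilon> / 4 * norm (d l)"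
        using max G(2) \<epsilon> by simp
      moreover have "\<epsilon> / 2 * norm (d l) \<le> 2 * norm (\<Sum>j\<in>G. sc (d j) (x (r j)))"
        using dom[rule_format, of G l d, OF G(1) l(1)] max \<phi>(2) order_trans by blast
      ultimately show ?thesis by simp
    qed
  qed (use \<epsilon> in simp)
qed

text \<open>
  A weak limit \<open>w\<close> of the partial sums is annihilated by every functional that vanishes on the terms, so
  it is nearly a finite combination \<open>u\<close> of them. But a partial sum beyond that combination differs
  from \<open>u\<close> by a combination with a coefficient 1 at its end. The largest coefficient of this
  difference belongs to one of finitely many indices, the same index for all partial sums, so a single
  functional separates all of them from \<open>u\<close> and passes to the weak limit.
\<close>

theorem Orlicz_Pettis_subsequence:
  "\<exists>r :: nat \<Rightarrow> nat. strict_mono r \<and> (\<forall>w. \<not> weakly_converges sc (\<lambda>n. \<Sum>j<n. x (r j)) w)"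
proof -
  obtain r :: "nat \<Rightarrow> nat" and \<phi> where r: "strict_mono r" and \<phi>_dual: "\<forall>k. \<phi> k \<in> dual sc"
    and \<phi>_norm: "\<forall>k v. norm (\<phi> k v) \<le> 2 * norm v"
    and dom: "\<forall>k d G. finite G \<longrightarrow> k \<in> G \<longrightarrow> (\<forall>j\<in>G. norm (d j) \<le> norm (d k)) \<longrightarrow>
       \<epsilon> / 2 * norm (d k) \<le> norm (\<phi> k (\<Sum>j\<in>G. sc (d j) (x (r j))))"
    using dominant_coefficient_subsequence by (elim exE conjE)
  note \<phi> = \<phi>_dual[rule_format] \<phi>_norm[rule_format]
  have False if w: "weakly_converges sc (\<lambda>n. \<Sum>j<n. x (r j)) w" for w
  proof -
    define S where "S = span (range (\<lambda>j. x (r j)))"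
    have S: "subspace S" unfolding S_def by (rule subspace_span)
    have ann: "\<forall>\<psi>\<in>dual sc. (\<forall>u\<in>S. \<psi> u = 0) \<longrightarrow> \<psi> w = 0"
    proof (intro ballI impI)
      fix \<psi> assume \<psi>: "\<psi> \<in> dual sc" "\<forall>u\<in>S. \<psi> u = 0"
      have "(\<Sum>j<n. x (r j)) \<in> S" for n
        unfolding S_def by (intro span_sum span_base) auto
      then have "\<psi> (\<Sum>j<n. x (r j)) = 0" for n
        using \<psi>(2) by blast
      then show "\<psi> w = 0"
        using w \<psi>(1) by (auto simp: weakly_converges_def LIMSEQ_const_iff)
    qed
    have "\<epsilon> / 4 > 0" using \<epsilon> by simp
    then obtain u where u: "u \<in> S" "norm (w - u) < \<epsilon> / 4"
      using approximable_if_annihilated[OF S ann] by blast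
    obtain c n where c: "u = (\<Sum>j<n. sc (c j) (x (r j)))"
      using span_sequence[OF u(1)[unfolded S_def]] by blast
    \<comment> \<open>All coefficients beyond \<open>n\<close> equal 1, as does the one at \<open>n\<close>, so the maximum over all indices is
      attained among the first \<open>n + 1\<close> of them.\<close>
    define d where "d j = (if j < n then 1 - c j else 1)" for j
    have partial: "(\<Sum>j<m. x (r j)) - u = (\<Sum>j<m. sc (d j) (x (r j)))" if "m > n" for m
    proof -
      have "u = (\<Sum>j<m. if j < n then sc (c j) (x (r j)) else 0)"
        unfolding c using that by (intro sum.mono_neutral_cong_left) auto
      then show ?thesis
        by (auto simp: d_def scale_left_diff_distrib simp flip: sum_subtractf intro!: sum.cong)
    qed
    have "Max ((\<lambda>j. norm (d j)) ` {..n}) \<in> (\<lambda>j. norm (d j)) ` {..n}"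
      by (intro Max_in) auto
    then obtain k where k: "k \<le> n" "norm (d k) = Max ((\<lambda>j. norm (d j)) ` {..n})"
      by (metis atMost_iff imageE)
    then have max': "norm (d j) \<le> norm (d k)" if "j \<le> n" for j using that by simp
    have dk: "1 \<le> norm (d k)" using max'[of n] by (simp add: d_def)
    then have max: "norm (d j) \<le> norm (d k)" for j
      using max'[of j] by (cases "j \<le> n") (auto simp: d_def)
    have "(\<lambda>m. norm (\<phi> k ((\<Sum>j<m. x (r j)) - u))) \<longlonglongrightarrow> norm (\<phi> k (w - u))"
      using w \<phi>(1)[of k] by (auto simp: weakly_converges_def dual_diff[OF \<phi>(1)] intro!: tendsto_intros)
    moreover have "\<epsilon> / 2 \<le> norm (\<phi> k ((\<Sum>j<m. x (r j)) - u))" if "m > n" for m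
    proof -
      have "\<epsilon> / 2 * 1 \<le> \<epsilon> / 2 * norm (d k)" using dk \<epsilon> by (intro mult_left_mono) auto
      also have "\<dots> \<le> norm (\<phi> k (\<Sum>j<m. sc (d j) (x (r j))))"
        using dom max k(1) that by simp
      finally show ?thesis using partial[OF that] by simp
    qed
    ultimately have "\<epsilon> / 2 \<le> norm (\<phi> k (w - u))"
      by (intro LIMSEQ_le_const) (auto intro!: exI[of _ "Suc n"])
    also have "\<dots> \<le> 2 * norm (w - u)" by (rule \<phi>(2))
    finally show False using u(2) by simp
  qed
  with r show ?thesis by blast
qed

end

end

context enough_functionals
begin

section \<open>Almost additive set functions\<close>

text \<open>
  Adding up the errors shows that \<open>y A\<close> differs from \<open>y {} + sum x A\<close> by at most 2, so the finite sums of
  the \<open>x n\<close> are bounded. Along a subsequence without weakly convergent partial sums, the values of \<open>y\<close>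
  differ from these partial sums by a sequence that converges in norm. Hence they form a
  weakly Cauchy sequence without weak limit.
\<close>

theorem
  fixes x :: "nat \<Rightarrow> 'a" and y :: "nat set \<Rightarrow> 'a"
  assumes step: "\<And>n A. A \<subseteq> {..<n} \<Longrightarrow> norm (y (insert n A) - y A - x n) \<le> (1/2) ^ n"
    and bounded: "\<And>A. finite A \<Longrightarrow> norm (y A) \<le> B"
    and x: "\<And>n. \<epsilon> \<le> norm (x n)" and \<epsilon>: "\<epsilon> > 0"
  shows almost_additive_contains_c0: "contains_c0 sc"
    and almost_additive_not_weakly_complete: "\<not> rel_weakly_seq_complete sc (y ` {A. finite A})"
proof -
  have err: "norm (y A - y {} - (\<Sum>i\<in>A. x i)) \<le> 2 - 2 * (1/2) ^ n" if "A \<subseteq> {..<n}" for A n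
    using that
  proof (induction n arbitrary: A)
    case 0
    then show ?case by simp
  next
    case (Suc n)
    define A' where "A' = A - {n}"
    have A': "A' \<subseteq> {..<n}" using Suc.prems by (auto simp: A'_def less_Suc_eq)
    then have fin: "finite A'" using finite_subset by blast
    have nA': "n \<notin> A'" by (simp add: A'_def)
    show ?case
    proof (cases "n \<in> A")
      case True
      then have A: "A = insert n A'" by (auto simp: A'_def)
      have "y A - y {} - (\<Sum>i\<in>A. x i) = (y A' - y {} - (\<Sum>i\<in>A'. x i)) + (y A - y A' - x n)"
        using fin nA' unfolding A by simp
      also have "norm \<dots> \<le> (2 - 2 * (1/2) ^ n) + (1/2) ^ n"
        using Suc.IH[OF A'] step[OF A'] unfolding A by (intro norm_triangle_mono)
      finally show ?thesis by simp
    next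
      case False
      then have "A = A'" by (auto simp: A'_def)
      then have "norm (y A - y {} - (\<Sum>i\<in>A. x i)) \<le> 2 - 2 * (1/2) ^ n"
        using Suc.IH[OF A'] by simp
      also have "\<dots> \<le> 2 - 2 * (1/2) ^ Suc n" by simp
      finally show ?thesis .
    qed
  qed
  have sums: "norm (\<Sum>i\<in>A. x i) \<le> 2 + 2 * B" if A: "finite A" for A
  proof -
    obtain n where n: "A \<subseteq> {..<n}" using A finite_nat_iff_bounded by blast
    have "(\<Sum>i\<in>A. x i) = y A - y {} - (y A - y {} - (\<Sum>i\<in>A. x i))" by simp
    also have "norm \<dots> \<le> norm (y A) + norm (y {}) + norm (y A - y {} - (\<Sum>i\<in>A. x i))"
      by (meson add_mono norm_triangle_ineq4 order_refl order_trans)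
    also have "\<dots> \<le> B + B + 2"
    proof -
      have "0 \<le> (1/2::real) ^ n" by simp
      then show ?thesis using bounded[OF A] bounded[OF finite.emptyI] err[OF n] by linarith
    qed
    finally show ?thesis by simp
  qed
  show "contains_c0 sc"
    by (rule Bessaga_Pelczynski[OF sums x \<epsilon>])
  have "\<exists>r :: nat \<Rightarrow> nat. strict_mono r \<and>
      (\<forall>w. \<not> weakly_converges sc (\<lambda>n. \<Sum>j<n. x (r j)) w)"
    by (rule Orlicz_Pettis_subsequence[OF sums x \<epsilon>])
  then obtain r :: "nat \<Rightarrow> nat" where r: "strict_mono r"
    and no_limit: "\<And>w. \<not> weakly_converges sc (\<lambda>n. \<Sum>j<n. x (r j)) w"
    by blast
  define Y where "Y n = y (r ` {..<n})" for n
  define P where "P n = (\<Sum>j<n. x (r j))" for n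
  define e where "e n = Y n - y {} - P n" for n
  have "norm (e (Suc n) - e n) \<le> (1/2) ^ n" for n
  proof -
    have "e (Suc n) - e n = y (insert (r n) (r ` {..<n})) - y (r ` {..<n}) - x (r n)"
      by (simp add: e_def Y_def P_def lessThan_Suc)
    also have "norm \<dots> \<le> (1/2) ^ r n"
      using r by (intro step) (auto simp: strict_mono_less)
    also have "\<dots> \<le> (1/2) ^ n"
      using strict_mono_imp_increasing[OF r, of n] by (intro power_decreasing) auto
    finally show ?thesis .
  qed
  then have "summable (\<lambda>n. e (Suc n) - e n)"
    by (intro summable_comparison_test'[OF summable_geometric[of "1/2::real"]]) auto
  then have "(\<lambda>n. (\<Sum>j<n. e (Suc j) - e j) + e 0) \<longlonglongrightarrow> suminf (\<lambda>n. e (Suc n) - e n) + e 0"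
    by (intro tendsto_intros summable_LIMSEQ)
  then obtain l where l: "e \<longlonglongrightarrow> l"
    by (auto simp: sum_lessThan_telescope)
  have inj: "inj_on r G" for G
    using strict_mono_imp_inj_on[OF r] by (rule inj_on_subset) (rule subset_UNIV)
  have P_Cauchy: "\<exists>p. (\<lambda>n. \<phi> (P n)) \<longlonglongrightarrow> p" if \<phi>: "\<phi> \<in> dual sc" for \<phi>
  proof -
    obtain \<kappa> where \<kappa>: "\<And>v. norm (\<phi> v) \<le> \<kappa> * norm v" "\<kappa> \<ge> 0"
      using \<phi> bounded_linear.nonneg_bounded[of \<phi>] by (auto simp: dual_def mult.commute)
    have "summable (\<lambda>j. norm (\<phi> (x (r j))))"
    proof (rule summableI_nonneg_bounded)
      fix n
      have "(\<Sum>j<n. norm (\<phi> (x (r j)))) = (\<Sum>j\<in>r ` {..<n}. norm (\<phi> (x j)))"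
        using inj by (simp add: sum.reindex)
      also have "\<dots> \<le> 2 * real DIM('k) * (\<kappa> * (2 + 2 * B))"
        by (intro functional_abs_sum_le[OF \<phi> \<kappa> sums]) auto
      finally show "(\<Sum>j<n. norm (\<phi> (x (r j)))) \<le> 2 * real DIM('k) * (\<kappa> * (2 + 2 * B))" .
    qed simp
    then show ?thesis
      unfolding P_def dual_sum[OF \<phi>] by (blast intro: summable_LIMSEQ summable_norm_cancel)
  qed
  show "\<not> rel_weakly_seq_complete sc (y ` {A. finite A})"
  proof
    assume complete: "rel_weakly_seq_complete sc (y ` {A. finite A})"
    have Y_eq: "Y n = y {} + P n + e n" for n by (simp add: e_def)
    have "Cauchy (\<lambda>n. \<phi> (Y n))" if \<phi>: "\<phi> \<in> dual sc" for \<phi>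
    proof -
      obtain p where "(\<lambda>n. \<phi> (P n)) \<longlonglongrightarrow> p" using P_Cauchy[OF \<phi>] by blast
      then have "(\<lambda>n. \<phi> (Y n)) \<longlonglongrightarrow> \<phi> (y {}) + p + \<phi> l"
        unfolding Y_eq dual_add[OF \<phi>] by (intro tendsto_intros dual_tendsto[OF \<phi> l])
      then show ?thesis by (rule LIMSEQ_imp_Cauchy)
    qed
    then have "weakly_Cauchy sc Y" by (simp add: weakly_Cauchy_def)
    moreover have "range Y \<subseteq> y ` {A. finite A}" by (auto simp: Y_def)
    ultimately obtain a where a: "weakly_converges sc Y a"
      using complete unfolding rel_weakly_seq_complete_def by blast
    have "weakly_converges sc P (a - y {} - l)"
      unfolding weakly_converges_def
    proof
      fix \<phi> assume \<phi>: "\<phi> \<in> dual sc"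
      have "(\<lambda>n. \<phi> (Y n) - \<phi> (y {}) - \<phi> (e n)) \<longlonglongrightarrow> \<phi> a - \<phi> (y {}) - \<phi> l"
        using a \<phi> by (intro tendsto_intros dual_tendsto[OF \<phi> l]) (auto simp: weakly_converges_def)
      moreover have "\<phi> (P n) = \<phi> (Y n) - \<phi> (y {}) - \<phi> (e n)" for n
        by (simp add: Y_eq dual_add[OF \<phi>])
      ultimately show "(\<lambda>n. \<phi> (P n)) \<longlonglongrightarrow> \<phi> (a - y {} - l)"
        by (simp add: dual_diff[OF \<phi>])
    qed
    then show False using no_limit unfolding P_def by blast
  qed
qed

end

section \<open>Returns of the differences that are not returns of the function\<close>

lemma rel_dense_mono: "rel_dense S \<Longrightarrow> S \<subseteq> T \<Longrightarrow> rel_dense T"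
  unfolding rel_dense_def
proof (elim exE conjE)
  fix L assume *: "S \<subseteq> T" "compact L" "{\<tau> + l |\<tau> l. \<tau> \<in> S \<and> l \<in> L} = UNIV"
  then have "{\<tau> + l |\<tau> l. \<tau> \<in> T \<and> l \<in> L} = UNIV" by blast
  with * show "\<exists>L. compact L \<and> {\<tau> + l |\<tau> l. \<tau> \<in> T \<and> l \<in> L} = UNIV" by blast
qed

lemma common_denominator:
  assumes "finite \<Sigma>" "\<Sigma> \<subseteq> \<rat>"
  shows "\<exists>N>0. \<forall>\<sigma>\<in>\<Sigma>. \<exists>m::int. \<sigma> * real N = of_int m"
  using assms
proof (induction \<Sigma> rule: finite_induct)
  case empty
  then show ?case by (intro exI[of _ 1]) simp
next
  case (insert \<sigma> \<Sigma>)
  then obtain N where N: "N > 0" "\<forall>\<sigma>\<in>\<Sigma>. \<exists>m::int. \<sigma> * real N = of_int m" by auto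
  obtain p q :: int where pq: "q > 0" "\<sigma> = of_int p / of_int q"
    using insert.prems Rats_cases' by (metis insert_subset)
  define N' where "N' = N * nat q"
  have eq: "real N' = real N * of_int q" using pq(1) by (simp add: N'_def)
  have "N' > 0" using N(1) pq(1) by (simp add: N'_def)
  moreover have "\<exists>m::int. s * real N' = of_int m" if "s \<in> insert \<sigma> \<Sigma>" for s
  proof (cases "s = \<sigma>")
    case True
    then have "s * real N' = of_int (p * int N)" using pq by (simp add: eq)
    then show ?thesis by blast
  next
    case False
    then obtain m :: int where "s * real N = of_int m" using N(2) \<open>s \<in> insert \<sigma> \<Sigma>\<close> by auto
    then have "s * real N' = of_int (m * q)" by (simp add: eq)
    then show ?thesis by blast
  qed
  ultimately show ?case by blast
qed

lemma common_divisor: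
  assumes \<Sigma>: "finite \<Sigma>" "\<Sigma> \<subseteq> \<rat>" and e: "e > 0"
  obtains h :: real where "0 < h" "h < e" "\<And>\<sigma>. \<sigma> \<in> \<Sigma> \<Longrightarrow> \<exists>m::int. \<sigma> = of_int m * h"
proof -
  obtain N :: nat where N: "N > 0" "\<forall>\<sigma>\<in>\<Sigma>. \<exists>m::int. \<sigma> * real N = of_int m"
    using common_denominator[OF \<Sigma>] by blast
  obtain k :: nat where k: "1 / real (Suc k) < e"
    using nat_approx_posE[OF e] by blast
  define h where "h = 1 / (real N * real (Suc k))"
  have "1 * real (Suc k) \<le> real N * real (Suc k)"
    using N(1) by (intro mult_right_mono) auto
  then have "h \<le> 1 / real (Suc k)"
    unfolding h_def by (intro frac_le) auto
  then have "h < e" using k by simp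
  moreover have "0 < h" using N(1) by (simp add: h_def)
  moreover have "\<exists>m::int. \<sigma> = of_int m * h" if \<sigma>: "\<sigma> \<in> \<Sigma>" for \<sigma>
  proof -
    obtain m :: int where "\<sigma> * real N = of_int m" using N(2) \<sigma> by blast
    then have "\<sigma> = of_int (m * int (Suc k)) * h"
      using N(1) by (simp add: h_def field_simps del: of_nat_Suc)
    then show ?thesis by blast
  qed
  ultimately show ?thesis using that by blast
qed

lemma almost_periodic_steps_nat:
  fixes \<Phi> :: "real \<Rightarrow> 'a::real_normed_vector"
  assumes per: "\<And>v. \<bar>v\<bar> \<le> B \<Longrightarrow> norm (\<Phi> (v + h) - \<Phi> v) \<le> \<delta>"
    and h: "h > 0" and v: "\<bar>v\<bar> \<le> B" "\<bar>v + real m * h\<bar> \<le> B"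
  shows "norm (\<Phi> (v + real m * h) - \<Phi> v) \<le> real m * \<delta>"
  using v(2)
proof (induction m)
  case 0
  then show ?case by simp
next
  case (Suc m)
  have eq: "v + real (Suc m) * h = (v + real m * h) + h" by (simp add: algebra_simps)
  have "0 \<le> real m * h" using h by simp
  then have B: "\<bar>v + real m * h\<bar> \<le> B"
    using v(1) Suc.prems h unfolding eq by linarith
  have "\<Phi> (v + real (Suc m) * h) - \<Phi> v =
      (\<Phi> ((v + real m * h) + h) - \<Phi> (v + real m * h)) + (\<Phi> (v + real m * h) - \<Phi> v)"
    unfolding eq by simp
  also have "norm \<dots> \<le> \<delta> + real m * \<delta>"
    by (intro norm_triangle_mono per Suc.IH B)
  finally show ?case by (simp add: algebra_simps)
qed

lemma almost_periodic_steps: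
  fixes \<Phi> :: "real \<Rightarrow> 'a::real_normed_vector"
  assumes per: "\<And>v. \<bar>v\<bar> \<le> B \<Longrightarrow> norm (\<Phi> (v + h) - \<Phi> v) \<le> \<delta>"
    and h: "h > 0" and v: "\<bar>v\<bar> \<le> B" "\<bar>v + of_int m * h\<bar> \<le> B"
  shows "norm (\<Phi> (v + of_int m * h) - \<Phi> v) \<le> of_int \<bar>m\<bar> * \<delta>"
proof (cases "m \<ge> 0")
  case True
  then have "of_int m = real (nat m)" by simp
  then show ?thesis
    using almost_periodic_steps_nat[of B \<Phi> h \<delta> v "nat m"] per h v True by simp
next
  case False
  define k where "k = nat (- m)"
  have m: "of_int m * h = - (real k * h)" "real_of_int \<bar>m\<bar> = real k"
    using False by (simp_all add: k_def)
  have "norm (\<Phi> ((v + of_int m * h) + real k * h) - \<Phi> (v + of_int m * h)) \<le> real k * \<delta>"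
  proof (rule almost_periodic_steps_nat[of B])
    show "\<bar>v + of_int m * h + real k * h\<bar> \<le> B" using v(1) by (simp add: m(1))
  qed (rule per h v(2), assumption?)+
  then show ?thesis unfolding m by (simp add: norm_minus_commute)
qed

text \<open>
  The return times of \<open>\<Delta> h F\<close> are relatively dense, those of \<open>F\<close> are not, so some return time of the
  former is not one of the latter. Both requirements tolerate a small change of the time once the
  tolerance is halved, which allows a rational one.
\<close>

lemma rational_return:
  fixes F :: "real \<Rightarrow> 'a::banach"
  assumes F: "continuous_on UNIV F"
    and no: "\<not> rel_dense (E_rec F \<epsilon> K)"
    and h: "\<Delta> h F \<in> REC" and \<delta>: "\<delta> > 0"
  obtains s t where "s \<in> \<rat>" "t \<in> K" "\<epsilon> < norm (F (t + s) - F t)"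
    "\<And>v. \<bar>v\<bar> \<le> B \<Longrightarrow> norm (\<Delta> h F (v + s) - \<Delta> h F v) \<le> \<delta>"
proof -
  have cont: "continuous_on UNIV (\<Delta> h F)" using h by (simp add: REC_def)
  have "rel_dense (E_rec (\<Delta> h F) (\<delta> / 2) {- B..B})"
    using h \<delta> by (simp add: REC_def)
  then have "\<not> E_rec (\<Delta> h F) (\<delta> / 2) {- B..B} \<subseteq> E_rec F \<epsilon> K"
    using no rel_dense_mono by blast
  then obtain s0 where s0: "s0 \<in> E_rec (\<Delta> h F) (\<delta> / 2) {- B..B}" "s0 \<notin> E_rec F \<epsilon> K"
    by blast
  obtain t where t: "t \<in> K" "\<epsilon> < norm (F (t + s0) - F t)"
    using s0(2) unfolding E_rec_def by (auto simp: not_le)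
  define I where "I = {- (\<bar>B\<bar> + \<bar>s0\<bar> + 1)..\<bar>B\<bar> + \<bar>s0\<bar> + 1}"
  have "uniformly_continuous_on I (\<Delta> h F)"
    unfolding I_def by (intro compact_uniformly_continuous continuous_on_subset[OF cont]) auto
  then obtain d where d: "d > 0" "\<And>v w. v \<in> I \<Longrightarrow> w \<in> I \<Longrightarrow> dist w v < d \<Longrightarrow>
      dist (\<Delta> h F w) (\<Delta> h F v) < \<delta> / 2"
    unfolding uniformly_continuous_on_def using \<delta> by (metis half_gt_zero)
  have "continuous_on UNIV (\<lambda>s. norm (F (t + s) - F t))"
    by (intro continuous_intros continuous_on_compose2[OF F]) auto
  then have "isCont (\<lambda>s. norm (F (t + s) - F t)) s0"
    by (simp add: continuous_on_eq_continuous_at)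
  then have "\<forall>\<^sub>F s in at s0. \<epsilon> < norm (F (t + s) - F t)"
    unfolding isCont_def using t(2) by (rule order_tendstoD)
  then obtain d' where d': "d' > 0" "\<And>s. dist s s0 < d' \<Longrightarrow> s \<noteq> s0 \<Longrightarrow> \<epsilon> < norm (F (t + s) - F t)"
    unfolding eventually_at by auto
  obtain s where s: "s \<in> \<rat>" "s0 < s" "s < s0 + min 1 (min d d')"
    using Rats_dense_in_real[of s0 "s0 + min 1 (min d d')"] d(1) d'(1) by auto
  have "\<epsilon> < norm (F (t + s) - F t)"
    using s by (intro d'(2)) (auto simp: dist_real_def)
  moreover have "norm (\<Delta> h F (v + s) - \<Delta> h F v) \<le> \<delta>" if "\<bar>v\<bar> \<le> B" for v
  proof -
    have "norm (\<Delta> h F (v + s0) - \<Delta> h F v) \<le> \<delta> / 2"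
      using s0(1) that by (simp add: E_rec_def abs_le_iff)
    moreover have "dist (\<Delta> h F (v + s)) (\<Delta> h F (v + s0)) < \<delta> / 2"
      using that s by (intro d(2)) (auto simp: I_def dist_real_def)
    moreover have "norm (\<Delta> h F (v + s) - \<Delta> h F v) \<le>
        dist (\<Delta> h F (v + s)) (\<Delta> h F (v + s0)) + norm (\<Delta> h F (v + s0) - \<Delta> h F v)"
      unfolding dist_norm by norm
    ultimately show ?thesis by simp
  qed
  ultimately show ?thesis using that[of s t] s(1) t(1) by blast
qed

text \<open>
  The set \<open>\<Sigma>\<close> consists of the finite sums of the earlier return times and \<open>{a..b}\<close> is the interval of
  base points still available. With \<open>h\<close> a common divisor of \<open>\<Sigma>\<close> and \<open>s\<close> a return time of \<open>\<Delta> h F\<close>, the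
  function \<open>\<Phi> v = F (v + s) - F v\<close> is almost \<open>h\<close>-periodic, hence almost invariant under \<open>\<Sigma>\<close>. It exceeds
  \<open>\<epsilon>\<close> at some \<open>t \<in> K\<close>, and as \<open>h < b - a\<close>, some \<open>t + m * h\<close> lies in the interval.
\<close>

lemma Kadets_step:
  fixes F :: "real \<Rightarrow> 'a::banach"
  assumes F: "continuous_on UNIV F"
    and \<Delta>: "\<forall>h>0. \<Delta> h F \<in> REC"
    and K: "K \<subseteq> {- R..R}" and no: "\<not> rel_dense (E_rec F \<epsilon> K)" and \<epsilon>: "\<epsilon> > 0"
    and \<Sigma>: "finite \<Sigma>" "\<Sigma> \<subseteq> \<rat>"
    and ab: "- R \<le> a" "a < b" "b \<le> R" and \<eta>: "\<eta> > 0"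
  shows "\<exists>s a' b'. s \<in> \<rat> \<and> a \<le> a' \<and> a' < b' \<and> b' \<le> b \<and>
    (\<forall>u\<in>{a'..b'}. \<epsilon> / 2 \<le> norm (F (u + s) - F u)) \<and>
    (\<forall>u\<in>{a'..b'}. \<forall>\<sigma>\<in>\<Sigma>. norm (F (u + \<sigma> + s) - F (u + \<sigma>) - (F (u + s) - F u)) \<le> \<eta>)"
proof -
  obtain h where h: "0 < h" "h < b - a" and div: "\<And>\<sigma>. \<sigma> \<in> \<Sigma> \<Longrightarrow> \<exists>m::int. \<sigma> = of_int m * h"
    using common_divisor[OF \<Sigma>, of "b - a"] ab(2) by auto
  \<comment> \<open>\<open>D\<close> bounds the translations that occur: those by \<open>\<Sigma>\<close>, and the one that carries \<open>t\<close> into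
    \<open>{a..b}\<close>. A translation by at most \<open>D\<close> takes at most \<open>D / h\<close> steps of length \<open>h\<close>, each with
    error \<open>\<delta>\<close>.\<close>
  define D where "D = 2 * R + (\<Sum>\<sigma>\<in>\<Sigma>. \<bar>\<sigma>\<bar>)"
  define B where "B = R + D"
  define \<eta>' where "\<eta>' = min \<eta> (\<epsilon> / 2)"
  define \<delta> where "\<delta> = \<eta>' * h / (D + 1)"
  have R: "R > 0" using ab by linarith
  then have D: "D > 0" unfolding D_def by (intro add_pos_nonneg sum_nonneg) auto
  have \<eta>': "\<eta>' > 0" using \<eta> \<epsilon> by (simp add: \<eta>'_def)
  have \<delta>: "\<delta> > 0" using \<eta>' h D by (simp add: \<delta>_def)
  obtain s t where s: "s \<in> \<rat>" and t: "t \<in> K" "\<epsilon> < norm (F (t + s) - F t)"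
    and ret: "\<And>v. \<bar>v\<bar> \<le> B \<Longrightarrow> norm (\<Delta> h F (v + s) - \<Delta> h F v) \<le> \<delta>"
    using rational_return[OF F no \<Delta>[rule_format, OF h(1)] \<delta>, of B] by metis
  define \<Phi> where "\<Phi> v = F (v + s) - F v" for v
  have per: "norm (\<Phi> (v + h) - \<Phi> v) \<le> \<delta>" if "\<bar>v\<bar> \<le> B" for v
    using ret[OF that] by (simp add: \<Phi>_def \<Delta>_def algebra_simps)
  have shift: "norm (\<Phi> (v + of_int m * h) - \<Phi> v) \<le> \<eta>'"
    if v: "\<bar>v\<bar> \<le> R" and m: "\<bar>of_int m * h\<bar> \<le> D" for v and m :: int
  proof -
    have "norm (\<Phi> (v + of_int m * h) - \<Phi> v) \<le> of_int \<bar>m\<bar> * \<delta>"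
      using v m D by (intro almost_periodic_steps[of B \<Phi> h \<delta>] per h(1)) (auto simp: B_def)
    also have "of_int \<bar>m\<bar> * \<delta> = \<eta>' * (\<bar>of_int m * h\<bar> / (D + 1))"
      using h by (simp add: \<delta>_def abs_mult)
    also have "\<dots> \<le> \<eta>' * 1"
      using m D \<eta>' by (intro mult_left_mono) (auto simp: field_simps)
    finally show ?thesis by simp
  qed
  have "t \<in> {- R..R}" using t(1) K by blast
  then have tR: "\<bar>t\<bar> \<le> R" by (simp add: abs_le_iff)
  obtain m :: int where m: "a < t + of_int m * h" "t + of_int m * h < b"
  proof -
    define m where "m = \<lfloor>(a - t) / h\<rfloor> + 1"
    have "(a - t) / h < of_int m" "of_int m \<le> (a - t) / h + 1"
      unfolding m_def by linarith+
    then have "a - t < of_int m * h" "of_int m * h \<le> a - t + h"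
      using h(1) by (simp_all add: field_simps)
    then show ?thesis using h(2) by (intro that[of m]) linarith+
  qed
  define u0 where "u0 = t + of_int m * h"
  have "\<bar>of_int m * h\<bar> \<le> 2 * R" using m tR ab by linarith
  also have "\<dots> \<le> D" by (simp add: D_def sum_nonneg)
  finally have "norm (\<Phi> u0 - \<Phi> t) \<le> \<eta>'" unfolding u0_def by (rule shift[OF tR])
  moreover have "norm (\<Phi> t) \<le> norm (\<Phi> u0) + norm (\<Phi> u0 - \<Phi> t)" by norm
  ultimately have u0: "\<epsilon> / 2 < norm (\<Phi> u0)"
    using t(2) unfolding \<Phi>_def \<eta>'_def by linarith
  have cont: "continuous_on UNIV \<Phi>"
    unfolding \<Phi>_def by (intro continuous_intros continuous_on_compose2[OF F]) auto
  have "open {u. \<epsilon> / 2 < norm (\<Phi> u)}"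
    by (intro open_Collect_less continuous_intros cont)
  then have "open ({u. \<epsilon> / 2 < norm (\<Phi> u)} \<inter> {a<..<b})" by (intro open_Int) auto
  moreover have "u0 \<in> {u. \<epsilon> / 2 < norm (\<Phi> u)} \<inter> {a<..<b}"
    using u0 m by (simp add: u0_def)
  ultimately obtain r where r: "r > 0" "cball u0 r \<subseteq> {u. \<epsilon> / 2 < norm (\<Phi> u)} \<inter> {a<..<b}"
    unfolding open_contains_cball by blast
  then have J: "{u0 - r..u0 + r} \<subseteq> {u. \<epsilon> / 2 < norm (\<Phi> u)} \<inter> {a<..<b}"
    by (simp add: cball_eq_atLeastAtMost)
  have ends: "u0 - r \<in> {a<..<b}" "u0 + r \<in> {a<..<b}" using J r(1) by (auto simp: subset_iff)
  have "norm (F (u + \<sigma> + s) - F (u + \<sigma>) - (F (u + s) - F u)) \<le> \<eta>"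
    if u: "u \<in> {u0 - r..u0 + r}" and \<sigma>: "\<sigma> \<in> \<Sigma>" for u \<sigma>
  proof -
    obtain k :: int where k: "\<sigma> = of_int k * h" using div[OF \<sigma>] by blast
    have "u \<in> {a<..<b}" using u J by blast
    then have "\<bar>u\<bar> \<le> R" using ab by auto
    moreover have "\<bar>\<sigma>\<bar> \<le> (\<Sum>\<sigma>\<in>\<Sigma>. \<bar>\<sigma>\<bar>)"
      using \<sigma> \<Sigma>(1) by (intro member_le_sum) auto
    then have "\<bar>of_int k * h\<bar> \<le> D" using R by (simp add: D_def k)
    ultimately have "norm (\<Phi> (u + of_int k * h) - \<Phi> u) \<le> \<eta>'" by (rule shift)
    then show ?thesis by (simp add: \<Phi>_def k \<eta>'_def)
  qed
  moreover have "\<epsilon> / 2 \<le> norm (F (u + s) - F u)" if "u \<in> {u0 - r..u0 + r}" for u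
    using that J by (auto simp: \<Phi>_def)
  ultimately show ?thesis
    using s ends r(1) by (intro exI[of _ s] exI[of _ "u0 - r"] exI[of _ "u0 + r"]) auto
qed

text \<open>The steps are iterated on triples of the finite sums so far and the two ends of the current
  interval; \<open>u\<close> lies in all the nested intervals.\<close>

lemma Kadets_sequence:
  fixes F :: "real \<Rightarrow> 'a::banach"
  assumes F: "continuous_on UNIV F" "F \<notin> REC"
    and \<Delta>: "\<forall>h>0. \<Delta> h F \<in> REC"
  obtains \<epsilon> u and s :: "nat \<Rightarrow> real" where "\<epsilon> > 0" "\<And>n. \<epsilon> \<le> norm (F (u + s n) - F u)"
    "\<And>n A. A \<subseteq> {..<n} \<Longrightarrow>
      norm (F (u + sum s A + s n) - F (u + sum s A) - (F (u + s n) - F u)) \<le> (1/2) ^ n"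
proof -
  obtain K \<epsilon> where K: "compact K" and \<epsilon>: "\<epsilon> > 0" and no: "\<not> rel_dense (E_rec F \<epsilon> K)"
    using F by (auto simp: REC_def)
  obtain R0 where R0: "\<And>t. t \<in> K \<Longrightarrow> \<bar>t\<bar> \<le> R0"
    using compact_imp_bounded[OF K] by (auto simp: bounded_iff)
  define R where "R = \<bar>R0\<bar> + 1"
  have KR: "K \<subseteq> {- R..R}"
  proof
    fix t assume "t \<in> K"
    from R0[OF this] show "t \<in> {- R..R}" by (simp add: R_def abs_le_iff)
  qed
  have R: "R \<ge> 1" by (simp add: R_def)
  define good where "good X \<longleftrightarrow> (case X of (\<Sigma>, a, b) \<Rightarrow>
      finite \<Sigma> \<and> \<Sigma> \<subseteq> \<rat> \<and> 0 \<in> \<Sigma> \<and> - R \<le> a \<and> a < b \<and> b \<le> R)" for X :: "real set \<times> real \<times> real"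
  define step where "step n s X X' \<longleftrightarrow> (case X of (\<Sigma>, a, b) \<Rightarrow> case X' of (\<Sigma>', a', b') \<Rightarrow>
      \<Sigma>' = \<Sigma> \<union> (\<lambda>\<sigma>. \<sigma> + s) ` \<Sigma> \<and> a \<le> a' \<and> b' \<le> b \<and>
      (\<forall>u\<in>{a'..b'}. \<epsilon> / 2 \<le> norm (F (u + s) - F u)) \<and>
      (\<forall>u\<in>{a'..b'}. \<forall>\<sigma>\<in>\<Sigma>. norm (F (u + \<sigma> + s) - F (u + \<sigma>) - (F (u + s) - F u)) \<le> (1/2) ^ n))"
    for n s and X X' :: "real set \<times> real \<times> real"
  have "\<exists>f. \<forall>n. good (f n) \<and> (\<exists>s. step n s (f n) (f (Suc n)))"
  proof (rule dependent_nat_choice)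
    show "\<exists>X. good X"
      using R by (intro exI[of _ "({0}, 0, 1)"]) (simp add: good_def)
  next
    fix X n assume "good X"
    moreover obtain \<Sigma> a b where X: "X = (\<Sigma>, a, b)" by (cases X)
    ultimately have g: "finite \<Sigma>" "\<Sigma> \<subseteq> \<rat>" "0 \<in> \<Sigma>" "- R \<le> a" "a < b" "b \<le> R"
      by (auto simp: good_def)
    have "(0::real) < (1/2) ^ n" by simp
    from Kadets_step[OF F(1) \<Delta> KR no \<epsilon> g(1,2,4,5,6) this]
    obtain s a' b' where s: "s \<in> \<rat>" "a \<le> a'" "a' < b'" "b' \<le> b"
      "\<forall>u\<in>{a'..b'}. \<epsilon> / 2 \<le> norm (F (u + s) - F u)"
      "\<forall>u\<in>{a'..b'}. \<forall>\<sigma>\<in>\<Sigma>. norm (F (u + \<sigma> + s) - F (u + \<sigma>) - (F (u + s) - F u)) \<le> (1/2) ^ n"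
      by (elim exE conjE)
    have "\<Sigma> \<union> (\<lambda>\<sigma>. \<sigma> + s) ` \<Sigma> \<subseteq> \<rat>"
      using g(2) s(1) by (auto intro: Rats_add)
    then have "good (\<Sigma> \<union> (\<lambda>\<sigma>. \<sigma> + s) ` \<Sigma>, a', b')"
      using g s(2-4) by (simp add: good_def)
    moreover have "step n s X (\<Sigma> \<union> (\<lambda>\<sigma>. \<sigma> + s) ` \<Sigma>, a', b')"
      using s by (simp add: step_def X)
    ultimately show "\<exists>X'. good X' \<and> (\<exists>s. step n s X X')" by blast
  qed
  then obtain f where f: "\<And>n. good (f n)" "\<forall>n. \<exists>s. step n s (f n) (f (Suc n))" by blast
  obtain s where st: "\<And>n. step n (s n) (f n) (f (Suc n))"
    using choice[OF f(2)] by blast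
  define \<Sigma> a b where "\<Sigma> n = fst (f n)" and "a n = fst (snd (f n))" and "b n = snd (snd (f n))" for n
  have f_eq: "f n = (\<Sigma> n, a n, b n)" for n by (simp add: \<Sigma>_def a_def b_def)
  have g: "0 \<in> \<Sigma> n" "a n < b n" for n
    using f(1)[of n] by (simp_all add: f_eq good_def)
  have \<Sigma>_Suc: "\<Sigma> (Suc n) = \<Sigma> n \<union> (\<lambda>\<sigma>. \<sigma> + s n) ` \<Sigma> n" and ab: "a n \<le> a (Suc n)" "b (Suc n) \<le> b n"
    and big: "\<forall>u\<in>{a (Suc n)..b (Suc n)}. \<epsilon> / 2 \<le> norm (F (u + s n) - F u)"
    and add: "\<forall>u\<in>{a (Suc n)..b (Suc n)}. \<forall>\<sigma>\<in>\<Sigma> n.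
      norm (F (u + \<sigma> + s n) - F (u + \<sigma>) - (F (u + s n) - F u)) \<le> (1/2) ^ n" for n
    using st[of n] by (simp_all add: f_eq step_def)
  have sums: "sum s A \<in> \<Sigma> n" if "A \<subseteq> {..<n}" for A n
    using that
  proof (induction n arbitrary: A)
    case 0
    then show ?case using g(1) by simp
  next
    case (Suc n)
    have "A - {n} \<subseteq> {..<n}" using Suc.prems by (auto simp: less_Suc_eq)
    then have IH: "sum s (A - {n}) \<in> \<Sigma> n" by (rule Suc.IH)
    show ?case
    proof (cases "n \<in> A")
      case True
      have "finite A" using Suc.prems finite_subset by blast
      then have "sum s A = sum s (A - {n}) + s n" using True by (simp add: sum.remove)
      then show ?thesis using IH by (simp add: \<Sigma>_Suc)
    next
      case False
      then show ?thesis using IH by (simp add: \<Sigma>_Suc)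
    qed
  qed
  have "\<Inter>(range (\<lambda>n. {a n..b n})) \<noteq> {}"
  proof (rule compact_nest)
    show "{a n..b n} \<noteq> {}" for n using g(2)[of n] by simp
    show "{a n..b n} \<subseteq> {a m..b m}" if "m \<le> n" for m n
      using lift_Suc_mono_le[of a, OF ab(1) that] lift_Suc_antimono_le[of b, OF ab(2) that] by auto
  qed auto
  then obtain u where u: "\<And>n. u \<in> {a n..b n}" by blast
  show ?thesis
  proof (rule that[of "\<epsilon> / 2" u s])
    show "\<epsilon> / 2 > 0" using \<epsilon> by simp
    show "\<epsilon> / 2 \<le> norm (F (u + s n) - F u)" for n
      using big[of n] u[of "Suc n"] by blast
    show "norm (F (u + sum s A + s n) - F (u + sum s A) - (F (u + s n) - F u)) \<le> (1/2) ^ n"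
      if "A \<subseteq> {..<n}" for n A
      using add[of n] u[of "Suc n"] sums[OF that] by blast
  qed
qed

section \<open>Differences of a primitive\<close>

lemma prim_has_vector_derivative:
  fixes f :: "real \<Rightarrow> 'a::banach"
  assumes f: "continuous_on UNIV f"
  shows "(prim f has_vector_derivative f t) (at t)"
proof -
  define c where "c = \<bar>t\<bar> + 1"
  have sub: "continuous_on I f" for I by (rule continuous_on_subset[OF f]) simp
  have int: "f integrable_on {p..q}" for p q
    by (rule integrable_continuous_real[OF sub])
  have "((\<lambda>v. integral {- c..v} f) has_vector_derivative f t) (at t within {- c..c})"
    by (rule integral_has_vector_derivative[OF sub]) (auto simp: c_def)
  moreover have "at t within {- c..c} = at t"
    by (rule at_within_interior) (auto simp: c_def interior_atLeastAtMost_real)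
  ultimately have "((\<lambda>v. integral {- c..v} f - integral {- c..0} f) has_vector_derivative f t - 0) (at t)"
    by (intro has_vector_derivative_diff has_vector_derivative_const) simp
  then have "((\<lambda>v. integral {- c..v} f - integral {- c..0} f) has_vector_derivative f t) (at t)"
    by simp
  then show ?thesis
  proof (rule has_vector_derivative_transform_within_open)
    show "open {- c<..<c}" "t \<in> {- c<..<c}" by (auto simp: c_def)
    fix v assume v: "v \<in> {- c<..<c}"
    show "integral {- c..v} f - integral {- c..0} f = prim f v"
    proof (cases "v \<ge> 0")
      case True
      then show ?thesis
        using v Henstock_Kurzweil_Integration.integral_combine[of "- c" 0 v f] int
        by (simp add: prim_continuous[OF f] c_def algebra_simps)
    next
      case False
      then show ?thesis
        using v Henstock_Kurzweil_Integration.integral_combine[of "- c" v 0 f] int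
        by (simp add: prim_continuous[OF f] algebra_simps)
    qed
  qed
qed

text \<open>If \<open>f\<close> changes by at most \<open>\<epsilon> / h\<close> under translation by \<open>\<tau>\<close> on \<open>K + [0, h]\<close>, its integrals over the
  intervals \<open>[t, t + h]\<close> with \<open>t \<in> K\<close> change by at most \<open>\<epsilon>\<close>; the mean value inequality expresses this
  without integrals.\<close>

lemma difference_of_prim_in_REC:
  fixes f :: "real \<Rightarrow> 'a::banach"
  assumes f: "f \<in> REC" and h: "h > 0"
  shows "\<Delta> h (prim f) \<in> REC"
proof -
  have cf: "continuous_on UNIV f" using f by (simp add: REC_def)
  note D = prim_has_vector_derivative[OF cf]
  have cont: "continuous_on UNIV (prim f)"
    using D by (auto simp: continuous_on_eq_continuous_at intro: has_vector_derivative_continuous)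
  have "rel_dense (E_rec (\<Delta> h (prim f)) \<epsilon> K)" if K: "compact K" and \<epsilon>: "\<epsilon> > 0" for \<epsilon> K
  proof (rule rel_dense_mono)
    define K' where "K' = {t + r |t r. t \<in> K \<and> r \<in> {0..h}}"
    have "compact K'" unfolding K'_def by (intro compact_sums K) auto
    then show "rel_dense (E_rec f (\<epsilon> / h) K')" using f \<epsilon> h by (simp add: REC_def)
    show "E_rec f (\<epsilon> / h) K' \<subseteq> E_rec (\<Delta> h (prim f)) \<epsilon> K"
    proof
      fix \<tau> assume \<tau>: "\<tau> \<in> E_rec f (\<epsilon> / h) K'"
      have "norm (\<Delta> h (prim f) (t + \<tau>) - \<Delta> h (prim f) t) \<le> \<epsilon>" if t: "t \<in> K" for t
      proof -
        define g where "g r = prim f (t + \<tau> + r) - prim f (t + r)" for r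
        have shift: "((\<lambda>r. prim f (c + r)) has_vector_derivative f (c + r)) (at r)" for c r
        proof -
          have "((\<lambda>r. c + r) has_vector_derivative 0 + 1) (at r)"
            by (intro has_vector_derivative_add has_vector_derivative_const has_vector_derivative_id)
          from vector_diff_chain_at[OF this D] show ?thesis by (simp add: comp_def)
        qed
        have g': "(g has_vector_derivative f (t + \<tau> + r) - f (t + r)) (at r)" for r
          unfolding g_def by (intro has_vector_derivative_diff shift)
        have "norm (g h - g 0) \<le> \<epsilon> / h * h - \<epsilon> / h * 0"
        proof (rule differentiable_bound_general[of 0 h g "\<lambda>r. \<epsilon> / h * r"
              "\<lambda>r. f (t + \<tau> + r) - f (t + r)" "\<lambda>r. \<epsilon> / h"])
          show "continuous_on {0..h} g"
            by (intro continuous_at_imp_continuous_on ballI has_vector_derivative_continuous[OF g'])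
          show "((\<lambda>r. \<epsilon> / h * r) has_vector_derivative \<epsilon> / h) (at r)" for r
            by (auto intro!: derivative_eq_intros)
          show "norm (f (t + \<tau> + r) - f (t + r)) \<le> \<epsilon> / h" if "0 < r" "r < h" for r
          proof -
            have "t + r \<in> K'"
              using t that unfolding K'_def by (intro CollectI exI[of _ t] exI[of _ r]) simp
            then have "norm (f (t + r + \<tau>) - f (t + r)) \<le> \<epsilon> / h"
              using \<tau> by (simp add: E_rec_def)
            then show ?thesis by (simp add: algebra_simps)
          qed
        qed (use h g' in \<open>auto intro!: continuous_intros\<close>)
        then show ?thesis
          using h by (simp add: g_def \<Delta>_def algebra_simps)
      qed
      then show "\<tau> \<in> E_rec (\<Delta> h (prim f)) \<epsilon> K" by (simp add: E_rec_def)
    qed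
  qed
  moreover have "continuous_on UNIV (\<Delta> h (prim f))"
    unfolding \<Delta>_def by (intro continuous_intros continuous_on_compose2[OF cont]) auto
  ultimately show ?thesis by (simp add: REC_def)
qed

section \<open>The two properties of the recurrent functions\<close>

context enough_functionals
begin

text \<open>The set function is \<open>A \<mapsto> F (u + sum s A)\<close>, with the point \<open>u\<close> and the times \<open>s\<close> from
  \<open>Kadets_sequence\<close>; its values lie in the range of \<open>F\<close>.\<close>

theorem
  fixes F :: "real \<Rightarrow> 'a"
  assumes F: "F \<in> bcontfun" "F \<notin> REC" and \<Delta>: "\<forall>h>0. \<Delta> h F \<in> REC"
  shows nonrecurrent_contains_c0: "contains_c0 sc"
    and nonrecurrent_not_weakly_complete: "\<not> rel_weakly_seq_complete sc (range F)"
proof -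
  have cont: "continuous_on UNIV F" and "bounded (range F)"
    using F(1) by (auto simp: bcontfun_def)
  then obtain B where B: "\<And>t. norm (F t) \<le> B" by (auto simp: bounded_iff)
  obtain \<epsilon> u and s :: "nat \<Rightarrow> real" where \<epsilon>: "\<epsilon> > 0" and big: "\<And>n. \<epsilon> \<le> norm (F (u + s n) - F u)"
    and add: "\<And>n A. A \<subseteq> {..<n} \<Longrightarrow>
      norm (F (u + sum s A + s n) - F (u + sum s A) - (F (u + s n) - F u)) \<le> (1/2) ^ n"
    using Kadets_sequence[OF cont F(2) \<Delta>] by metis
  define y where "y A = F (u + sum s A)" for A
  have step: "norm (y (insert n A) - y A - (F (u + s n) - F u)) \<le> (1/2) ^ n"
    if A: "A \<subseteq> {..<n}" for n A
  proof -
    have "finite A" "n \<notin> A" using A finite_subset by blast+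
    then have "y (insert n A) = F (u + sum s A + s n)"
      by (simp add: y_def add_ac)
    then show ?thesis using add[OF A] by (simp add: y_def)
  qed
  have bounded: "norm (y A) \<le> B" for A
    by (simp add: y_def B)
  show "contains_c0 sc"
    by (rule almost_additive_contains_c0[OF step bounded big \<epsilon>])
  have "\<not> rel_weakly_seq_complete sc (y ` {A. finite A})"
    by (rule almost_additive_not_weakly_complete[OF step bounded big \<epsilon>])
  moreover have "y ` {A. finite A} \<subseteq> range F" by (auto simp: y_def)
  ultimately show "\<not> rel_weakly_seq_complete sc (range F)"
    unfolding rel_weakly_seq_complete_def by (meson subset_trans)
qed

end

lemma REC_satisfies_P_if_L:
  assumes "satisfies_L U REC"
  shows "satisfies_P U REC"
  using assms difference_of_prim_in_REC unfolding satisfies_L_def satisfies_P_def by blast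

lemma REC_satisfies_L_and_P:
  fixes sc :: "'k::{real_normed_field,euclidean_space} \<Rightarrow> 'a::banach \<Rightarrow> 'a"
  assumes "enough_functionals sc"
  shows "(\<not> contains_c0 sc \<longrightarrow>
      satisfies_L bcontfun (REC :: (real \<Rightarrow> 'a) set) \<and> satisfies_P bcontfun (REC :: (real \<Rightarrow> 'a) set)) \<and>
    satisfies_L (Cb_wscp sc) REC \<and> satisfies_P (Cb_wscp sc) REC"
proof -
  interpret enough_functionals sc by (rule assms)
  have "satisfies_L bcontfun (REC :: (real \<Rightarrow> 'a) set)" if "\<not> contains_c0 sc"
    unfolding satisfies_L_def using nonrecurrent_contains_c0 that by blast
  moreover have "satisfies_L (Cb_wscp sc) REC"
    unfolding satisfies_L_def Cb_wscp_def using nonrecurrent_not_weakly_complete by blast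
  ultimately show ?thesis using REC_satisfies_P_if_L by blast
qed

theorem theorem4p5:
  shows "((\<not> contains_c0 ((*\<^sub>R) :: real \<Rightarrow> 'a::banach \<Rightarrow> 'a) \<longrightarrow>
            satisfies_L bcontfun (REC :: (real \<Rightarrow> 'a) set) \<and>
            satisfies_P bcontfun (REC :: (real \<Rightarrow> 'a) set)) \<and>
          satisfies_L (Cb_wscp ((*\<^sub>R) :: real \<Rightarrow> 'a \<Rightarrow> 'a)) REC \<and>
          satisfies_P (Cb_wscp ((*\<^sub>R) :: real \<Rightarrow> 'a \<Rightarrow> 'a)) REC) \<and>
         (\<forall>cscale :: complex \<Rightarrow> 'a \<Rightarrow> 'a. banach_over cscale \<longrightarrow>
           (\<not> contains_c0 cscale \<longrightarrow>
              satisfies_L bcontfun (REC :: (real \<Rightarrow> 'a) set) \<and>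
              satisfies_P bcontfun (REC :: (real \<Rightarrow> 'a) set)) \<and>
           satisfies_L (Cb_wscp cscale) REC \<and>
           satisfies_P (Cb_wscp cscale) REC)"
  using REC_satisfies_L_and_P[OF enough_functionals_real] REC_satisfies_L_and_P[OF enough_functionals_complex]
  by blast

end
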